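(* There is an algorithm to decide, for an arbitrary given pair of communicating SR-machines neither of which has a send cycle, whether the protocol is (simultaneously) affine and deadlock-free.
   Context: A pair of communicating SR-machines is a CFSM protocol with communication graph having nodes $\{0,1\}$ and two edges $\alpha$ (from $0$ to $1$) and $\beta$ (from $1$ to $0$), disjoint finite message alphabets $M_\alpha,M_\beta$, and two finite state machines $F_j=(K_j,\Sigma_j,T_j,h_j)$, $j=0,1$, with $\Sigma_0=\{-b:b\in M_\alpha\}\cup\{+b:b\in M_\beta\}$, $\Sigma_1=\{-b:b\in M_\beta\}\cup\{+b:b\in M_\alpha\}$, $K_j$ finite, $h_j\in K_j$ initial, $T_j\subseteq K_j\times\Sigma_j\times K_j$ (transitions $p\xrightarrow{e}q$; $+b$ = receive, $-b$ = send; $p\xrightarrow{w}q$ means a directed path labelled $w$). A send state has no outgoing $+b$ transition, a receive state no outgoing $-b$ transition. $F_j$ is an SR-machine if every state is a send or a receive state, its transition diagram is strongly connected, and it is deterministic. Global states are $((p_0,p_1),(x_\alpha,x_\beta))$; initially $((h_0,h_1),(\lambda,\lambda))$. A step is a send (a machine performs $p\xrightarrow{-b}q$ and $b$ is appended to its output channel: $\alpha$ for $F_0$, $\beta$ for $F_1$) or a receive (a machine performs $p\xrightarrow{+b}q$ and $b$ is removed from the front of its input channel, which must begin with $b$); the other machine is unchanged. A global state is deadlocked if both components are receive states and both channels are empty; deadlock-free means no reachable deadlocked global state. $\pi_\alpha(w)$ (resp. $\pi_\beta(w)$) is the string of $M_\alpha$- (resp. $M_\beta$-) symbols in $w$, in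 order, signs removed; $\mathbf Z_j=\{(\pi_\alpha(w),\pi_\beta(w)): h_j\xrightarrow{w}h_j\}$; the pair is affine if $\mathbf Z_0=\mathbf Z_1$. A send cycle of $F_j$ is a directed cycle in its transition diagram all of whose labels are of the form $-b$. *)

theory Defs
  imports Main "HOL-Library.Nat_Bijection"
begin

section \<open>A model of computation: (partial) recursive function terms\<close>

text \<open>Kleene-style general recursive function terms (zero, successor, projection,
composition, primitive recursion, unbounded minimisation) with a big-step
evaluation relation on argument lists of natural numbers.\<close>

datatype recf = Zf | Sf | Idf nat | Cnf recf "recf list" | Prf recf recf | Mnf recf

inductive rec_eval :: "recf \<Rightarrow> nat list \<Rightarrow> nat \<Rightarrow> bool" where
  ev_Z:  "rec_eval Zf [x] 0"
| ev_S:  "rec_eval Sf [x] (Suc x)"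
| ev_Id: "i < length xs \<Longrightarrow> rec_eval (Idf i) xs (xs ! i)"
| ev_Cn: "list_all2 (\<lambda>g y. rec_eval g xs y) gs ys \<Longrightarrow> rec_eval f ys y
          \<Longrightarrow> rec_eval (Cnf f gs) xs y"
| ev_Pr0: "rec_eval f xs y \<Longrightarrow> rec_eval (Prf f g) (0 # xs) y"
| ev_PrS: "rec_eval (Prf f g) (x # xs) y \<Longrightarrow> rec_eval g (x # y # xs) z
          \<Longrightarrow> rec_eval (Prf f g) (Suc x # xs) z"
| ev_Mn: "rec_eval f (y # xs) 0 \<Longrightarrow> (\<forall>i<y. \<exists>z. rec_eval f (i # xs) (Suc z))
          \<Longrightarrow> rec_eval (Mnf f) xs y"

text \<open>A total function on the naturals is computable if some recursive term computes it.\<close>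
definition computable :: "(nat \<Rightarrow> nat) \<Rightarrow> bool" where
  "computable f \<longleftrightarrow> (\<exists>r. \<forall>x. rec_eval r [x] (f x))"

section \<open>Pairs of communicating machines\<close>

text \<open>Messages are natural numbers.  \<open>Snd b\<close> is the label \<open>-b\<close>, \<open>Rcv b\<close> the label \<open>+b\<close>.\<close>
datatype act = Snd nat | Rcv nat

fun msg :: "act \<Rightarrow> nat" where
  "msg (Snd b) = b" | "msg (Rcv b) = b"

fun is_send :: "act \<Rightarrow> bool" where
  "is_send (Snd b) = True" | "is_send (Rcv b) = False"

text \<open>A finite state machine: finite set of states, finite set of transitions, initial state.\<close>
datatype fsm = FSM (states: "nat list") (trans: "(nat \<times> act \<times> nat) list") (initial: nat)

text \<open>A protocol with two machines: alphabets \<open>M_alpha\<close> (channel 0 \<rightarrow> 1), \<open>M_beta\<close>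
(channel 1 \<rightarrow> 0), and machines \<open>F_0\<close>, \<open>F_1\<close>.\<close>
datatype proto = Proto (M_alpha: "nat list") (M_beta: "nat list") (F0: fsm) (F1: fsm)

definition edges :: "fsm \<Rightarrow> (nat \<times> nat) set" where
  "edges F = {(p, q). \<exists>e. (p, e, q) \<in> set (trans F)}"

definition send_state :: "fsm \<Rightarrow> nat \<Rightarrow> bool" where
  "send_state F p \<longleftrightarrow> (\<forall>b q. (p, Rcv b, q) \<notin> set (trans F))"

definition receive_state :: "fsm \<Rightarrow> nat \<Rightarrow> bool" where
  "receive_state F p \<longleftrightarrow> (\<forall>b q. (p, Snd b, q) \<notin> set (trans F))"

text \<open>Transitions use states of the machine and labels from the given alphabet
\<open>Sig\<close>; the initial state is a state.\<close>
definition wf_fsm :: "act set \<Rightarrow> fsm \<Rightarrow> bool" where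
  "wf_fsm Sig F \<longleftrightarrow> initial F \<in> set (states F) \<and>
     (\<forall>(p, e, q) \<in> set (trans F). p \<in> set (states F) \<and> q \<in> set (states F) \<and> e \<in> Sig)"

definition sr_machine :: "act set \<Rightarrow> fsm \<Rightarrow> bool" where
  "sr_machine Sig F \<longleftrightarrow> wf_fsm Sig F
     \<and> (\<forall>p \<in> set (states F). send_state F p \<or> receive_state F p)
     \<and> (\<forall>p \<in> set (states F). \<forall>q \<in> set (states F). (p, q) \<in> (edges F)\<^sup>*)
     \<and> (\<forall>p e q q'. (p, e, q) \<in> set (trans F) \<longrightarrow> (p, e, q') \<in> set (trans F) \<longrightarrow> q = q')"

definition Sigma0 :: "proto \<Rightarrow> act set" where
  "Sigma0 P = {Snd b | b. b \<in> set (M_alpha P)} \<union> {Rcv b | b. b \<in> set (M_beta P)}"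

definition Sigma1 :: "proto \<Rightarrow> act set" where
  "Sigma1 P = {Snd b | b. b \<in> set (M_beta P)} \<union> {Rcv b | b. b \<in> set (M_alpha P)}"

text \<open>A pair of communicating SR-machines.\<close>
definition sr_pair :: "proto \<Rightarrow> bool" where
  "sr_pair P \<longleftrightarrow> set (M_alpha P) \<inter> set (M_beta P) = {}
     \<and> sr_machine (Sigma0 P) (F0 P) \<and> sr_machine (Sigma1 P) (F1 P)"

text \<open>A send cycle: a directed cycle all of whose labels are sends.\<close>
definition send_edges :: "fsm \<Rightarrow> (nat \<times> nat) set" where
  "send_edges F = {(p, q). \<exists>b. (p, Snd b, q) \<in> set (trans F)}"

definition has_send_cycle :: "fsm \<Rightarrow> bool" where
  "has_send_cycle F \<longleftrightarrow> (\<exists>p. (p, p) \<in> (send_edges F)\<^sup>+)"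

subsection \<open>Global semantics\<close>

type_synonym gstate = "(nat \<times> nat) \<times> (nat list \<times> nat list)"

inductive gstep :: "proto \<Rightarrow> gstate \<Rightarrow> gstate \<Rightarrow> bool" for P where
  send0: "(p0, Snd b, q) \<in> set (trans (F0 P)) \<Longrightarrow>
          gstep P ((p0, p1), (xa, xb)) ((q, p1), (xa @ [b], xb))"
| recv0: "(p0, Rcv b, q) \<in> set (trans (F0 P)) \<Longrightarrow>
          gstep P ((p0, p1), (xa, b # xb)) ((q, p1), (xa, xb))"
| send1: "(p1, Snd b, q) \<in> set (trans (F1 P)) \<Longrightarrow>
          gstep P ((p0, p1), (xa, xb)) ((p0, q), (xa, xb @ [b]))"
| recv1: "(p1, Rcv b, q) \<in> set (trans (F1 P)) \<Longrightarrow>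
          gstep P ((p0, p1), (b # xa, xb)) ((p0, q), (xa, xb))"

definition init_gstate :: "proto \<Rightarrow> gstate" where
  "init_gstate P = ((initial (F0 P), initial (F1 P)), ([], []))"

definition reachable :: "proto \<Rightarrow> gstate \<Rightarrow> bool" where
  "reachable P s \<longleftrightarrow> (gstep P)\<^sup>*\<^sup>* (init_gstate P) s"

definition deadlocked :: "proto \<Rightarrow> gstate \<Rightarrow> bool" where
  "deadlocked P s \<longleftrightarrow> (case s of ((p0, p1), (xa, xb)) \<Rightarrow>
     receive_state (F0 P) p0 \<and> receive_state (F1 P) p1 \<and> xa = [] \<and> xb = [])"

definition deadlock_free :: "proto \<Rightarrow> bool" where
  "deadlock_free P \<longleftrightarrow> (\<forall>s. reachable P s \<longrightarrow> \<not> deadlocked P s)"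

subsection \<open>Affineness\<close>

inductive path :: "fsm \<Rightarrow> nat \<Rightarrow> act list \<Rightarrow> nat \<Rightarrow> bool" for F where
  path_nil: "path F p [] p"
| path_cons: "(p, e, q) \<in> set (trans F) \<Longrightarrow> path F q w r \<Longrightarrow> path F p (e # w) r"

definition proj :: "nat list \<Rightarrow> act list \<Rightarrow> nat list" where
  "proj M w = [msg e. e \<leftarrow> w, msg e \<in> set M]"

definition Zset :: "proto \<Rightarrow> fsm \<Rightarrow> (nat list \<times> nat list) set" where
  "Zset P F = {(proj (M_alpha P) w, proj (M_beta P) w) | w. path F (initial F) w (initial F)}"

definition affine :: "proto \<Rightarrow> bool" where
  "affine P \<longleftrightarrow> Zset P (F0 P) = Zset P (F1 P)"

subsection \<open>Encoding protocols as natural numbers (input of the algorithm)\<close>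

fun enc_act :: "act \<Rightarrow> nat" where
  "enc_act (Snd b) = 2 * b" | "enc_act (Rcv b) = 2 * b + 1"

definition enc_trans :: "nat \<times> act \<times> nat \<Rightarrow> nat" where
  "enc_trans t = (case t of (p, e, q) \<Rightarrow> prod_encode (p, prod_encode (enc_act e, q)))"

definition enc_fsm :: "fsm \<Rightarrow> nat" where
  "enc_fsm F = list_encode [list_encode (states F), list_encode (map enc_trans (trans F)), initial F]"

definition enc_proto :: "proto \<Rightarrow> nat" where
  "enc_proto P = list_encode [list_encode (M_alpha P), list_encode (M_beta P),
                              enc_fsm (F0 P), enc_fsm (F1 P)]"

end

theory Submission
  imports Defs
begin

text \<open>
  Both machines are read as deterministic two-tape acceptors of pairs of an \<open>\<alpha>\<close>-word and a
  \<open>\<beta>\<close>-word; affineness says that they accept the same relation.  Since the first machine has no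
  send cycle, it cannot send much while receiving little.  If the pair is affine, the second machine
  therefore cannot receive much while sending little, so the second machine, reading the tapes written
  by the first one, lags behind it by a bounded number of symbols: the first machine can always close
  its path to a loop by a short path, and the second machine has to accept that loop.  Hence there are
  boundedly many configurations consisting of the two states and the lag, and any violation of
  affineness or deadlock-freeness can be pumped down to one of bounded length.  Deadlocks fit in
  because a deadlock is reachable iff two paths with equal projections end in receive states.  The
  algorithm searches for a violation up to the length bound.
\<close>

section \<open>Closure properties of computable functions\<close>

text \<open>The obstacle is circularity: the lag is bounded by means of affineness, which is itself
  to be decided. Two observations break the circle. The bound on blocks of receives uses only loops
  short enough to be covered by the search. The bound on the lag along a run \<open>u\<close> uses
  only loops shorter than \<open>u\<close>, whose acceptance is available by induction on length. So
  a successful search yields both bounds without assuming affineness.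

  A configuration is all that matters because a state of an SR-machine fixes the tape to be read
  next. With determinism, a run is then determined by its two projections, and its continuations
  depend only on the state and the unread symbols. Excising a segment between equal configurations
  therefore preserves the end state of the first machine and the set of end states of matching runs
  of the second, which is why loops and deadlocks are pumped at once.

  The reverse inclusion of affineness comes from the same argument with the machines exchanged and
  \<open>A\<close> complemented. All bounds are expressed in one number \<open>n\<close>, finally
  taken to be the code of the protocol.\<close>

lemma rec_eval_Cn1: "rec_eval g xs a \<Longrightarrow> rec_eval f [a] y \<Longrightarrow> rec_eval (Cnf f [g]) xs y"
  by (rule ev_Cn[where ys="[a]"]) auto

lemma rec_eval_Cn2:
  "rec_eval g xs a \<Longrightarrow> rec_eval h xs b \<Longrightarrow> rec_eval f [a, b] y \<Longrightarrow> rec_eval (Cnf f [g, h]) xs y"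
  by (rule ev_Cn[where ys="[a, b]"]) auto

lemma rec_eval_Id: "i < length xs \<Longrightarrow> y = xs ! i \<Longrightarrow> rec_eval (Idf i) xs y"
  using ev_Id by simp

lemma rec_eval_Pr:
  assumes "rec_eval f xs b" and "\<And>k a. rec_eval g (k # a # xs) (s k a)"
  shows "rec_eval (Prf f g) (x # xs) (rec_nat b s x)"
  by (induction x) (auto intro: ev_Pr0 ev_PrS assms)

text \<open>Since \<open>computable\<close> covers unary functions only, binary ones serve to
  bootstrap addition, subtraction and pairing; afterwards further arguments are packed into one
  number.\<close>

definition bin_computable :: "(nat \<Rightarrow> nat \<Rightarrow> nat) \<Rightarrow> bool" where
  "bin_computable f \<longleftrightarrow> (\<exists>r. \<forall>x y. rec_eval r [x, y] (f x y))"

lemma computable_id: "computable (\<lambda>x. x)"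
  unfolding computable_def by (intro exI[of _ "Idf 0"] allI rec_eval_Id) auto

lemma computable_comp: "computable f \<Longrightarrow> computable g \<Longrightarrow> computable (\<lambda>x. f (g x))"
  unfolding computable_def by (blast intro: rec_eval_Cn1)

lemma computable_bin:
  assumes "bin_computable f" "computable g" "computable h"
  shows "computable (\<lambda>x. f (g x) (h x))"
proof -
  obtain r s t where "\<forall>x y. rec_eval r [x, y] (f x y)" "\<forall>x. rec_eval s [x] (g x)"
    "\<forall>x. rec_eval t [x] (h x)"
    using assms unfolding computable_def bin_computable_def by auto
  then have "rec_eval (Cnf r [s, t]) [x] (f (g x) (h x))" for x
    by (intro rec_eval_Cn2) auto
  then show ?thesis unfolding computable_def by auto
qed

lemma computable_Suc: "computable f \<Longrightarrow> computable (\<lambda>x. Suc (f x))"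
  by (rule computable_comp[of Suc]) (auto simp: computable_def intro!: exI[of _ Sf] ev_S)

lemma computable_const: "computable (\<lambda>x. c)"
proof (induction c)
  case 0
  show ?case by (auto simp: computable_def intro: ev_Z)
next
  case (Suc c)
  then show ?case by (rule computable_Suc)
qed

lemma bin_computable_comp2:
  assumes "bin_computable f" "bin_computable g" "bin_computable h"
  shows "bin_computable (\<lambda>x y. f (g x y) (h x y))"
proof -
  obtain r s t where "\<forall>x y. rec_eval r [x, y] (f x y)" "\<forall>x y. rec_eval s [x, y] (g x y)"
    "\<forall>x y. rec_eval t [x, y] (h x y)"
    using assms unfolding bin_computable_def by auto
  then have "rec_eval (Cnf r [s, t]) [x, y] (f (g x y) (h x y))" for x y
    by (intro rec_eval_Cn2) auto
  then show ?thesis unfolding bin_computable_def by auto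
qed

lemma bin_computable_comp1:
  assumes "computable f" "bin_computable g"
  shows "bin_computable (\<lambda>x y. f (g x y))"
proof -
  obtain r s where "\<forall>x. rec_eval r [x] (f x)" "\<forall>x y. rec_eval s [x, y] (g x y)"
    using assms unfolding computable_def bin_computable_def by auto
  then have "rec_eval (Cnf r [s]) [x, y] (f (g x y))" for x y
    by (intro rec_eval_Cn1) auto
  then show ?thesis unfolding bin_computable_def by auto
qed

lemma bin_computable_fst: "bin_computable (\<lambda>x y. x)"
  unfolding bin_computable_def by (intro exI[of _ "Idf 0"] allI rec_eval_Id) auto

lemma bin_computable_snd: "bin_computable (\<lambda>x y. y)"
  unfolding bin_computable_def by (intro exI[of _ "Idf 1"] allI rec_eval_Id) auto

lemma rec_eval_bin_weaken:
  assumes "\<And>x y. rec_eval r [x, y] (f x y)"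
  shows "rec_eval (Cnf r [Idf 0, Idf 1]) (x # y # zs) (f x y)"
  using assms by (auto intro!: rec_eval_Cn2 rec_eval_Id)

lemma bin_computable_rec:
  assumes "computable f" "bin_computable g"
  shows "bin_computable (\<lambda>x y. rec_nat (f y) g x)"
proof -
  obtain rf rg where "\<And>x. rec_eval rf [x] (f x)" "\<And>x y. rec_eval rg [x, y] (g x y)"
    using assms unfolding computable_def bin_computable_def by blast
  then have "rec_eval (Prf rf (Cnf rg [Idf 0, Idf 1])) [x, y] (rec_nat (f y) g x)" for x y
    by (intro rec_eval_Pr rec_eval_bin_weaken)
  then show ?thesis unfolding bin_computable_def by blast
qed

lemma computable_rec_closed:
  assumes "bin_computable g"
  shows "computable (rec_nat c g)"
  using computable_bin[OF bin_computable_rec[OF computable_const assms] computable_id computable_id]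
  by simp

lemma bin_computable_add: "bin_computable (+)"
proof -
  have eq: "(+) = (\<lambda>x y :: nat. rec_nat y (\<lambda>k a. Suc a) x)"
  proof (intro ext)
    show "x + y = rec_nat y (\<lambda>k a. Suc a) x" for x y :: nat by (induction x) auto
  qed
  have "bin_computable (\<lambda>k a. Suc a)"
    by (intro bin_computable_comp1[of Suc] bin_computable_snd computable_Suc computable_id)
  then show ?thesis
    by (subst eq) (rule bin_computable_rec[OF computable_id])
qed

lemma computable_pred: "computable (\<lambda>x. x - 1)"
proof -
  have "(\<lambda>x. x - 1) = rec_nat 0 (\<lambda>k a. k)"
  proof
    show "x - 1 = rec_nat 0 (\<lambda>k a. k) x" for x by (cases x) auto
  qed
  then show ?thesis using computable_rec_closed[OF bin_computable_fst] by simp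
qed

lemma bin_computable_diff: "bin_computable (-)"
proof -
  have eq: "(\<lambda>x y. y - x) = (\<lambda>x y. rec_nat y (\<lambda>k a. a - 1) x)"
  proof (intro ext)
    show "y - x = rec_nat y (\<lambda>k a. a - 1) x" for x y :: nat by (induction x) auto
  qed
  have "bin_computable (\<lambda>x y. y - x)"
    by (subst eq)
      (rule bin_computable_rec[OF computable_id bin_computable_comp1[OF computable_pred bin_computable_snd]])
  from bin_computable_comp2[OF this bin_computable_snd bin_computable_fst] show ?thesis .
qed

section \<open>Inverting the pairing function\<close>

lemma computable_triangle: "computable triangle"
proof -
  have eq: "triangle = rec_nat 0 (\<lambda>k a. a + Suc k)"
  proof
    show "triangle k = rec_nat 0 (\<lambda>k a. a + Suc k) k" for k by (induction k) auto
  qed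
  have "bin_computable (\<lambda>k a. a + Suc k)"
    by (intro bin_computable_comp2[OF bin_computable_add] bin_computable_snd
        bin_computable_comp1[of Suc] bin_computable_fst computable_Suc computable_id)
  then show ?thesis by (subst eq) (rule computable_rec_closed)
qed

text \<open>The sum of the two components of the pair coded by a number, by recursion on the code.\<close>
definition diagonal :: "nat \<Rightarrow> nat" where
  "diagonal = rec_nat 0 (\<lambda>k d. d + (1 - (triangle (Suc d) - Suc k)))"

lemma computable_diagonal: "computable diagonal"
  unfolding diagonal_def
  by (intro computable_rec_closed bin_computable_comp2[OF bin_computable_add]
      bin_computable_comp2[OF bin_computable_diff] bin_computable_comp1[OF computable_const[of 1], of "\<lambda>k d. k"]
      bin_computable_comp1[OF computable_triangle] bin_computable_comp1[of Suc]
      bin_computable_fst bin_computable_snd computable_Suc computable_id)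

text \<open>The term \<open>1 - (triangle (Suc d) - Suc k)\<close> is the test whether
  \<open>Suc k\<close> has reached the next triangular number. The bounds identify
  \<open>diagonal k\<close> as the index of the last triangular number not above \<open>k\<close>,
  which is what inverting \<open>prod_encode\<close> requires.\<close>

lemma diagonal_bounds: "triangle (diagonal k) \<le> k \<and> k < triangle (Suc (diagonal k))"
proof (induction k)
  case (Suc k)
  have "diagonal (Suc k) = diagonal k + (1 - (triangle (Suc (diagonal k)) - Suc k))"
    by (simp add: diagonal_def)
  then have "diagonal (Suc k) = (if triangle (Suc (diagonal k)) \<le> Suc k then Suc (diagonal k) else diagonal k)"
    by auto
  with Suc show ?case by (simp split: if_splits)
qed (simp add: diagonal_def)

lemma prod_decode_diagonal:
  "prod_decode k = (k - triangle (diagonal k), diagonal k - (k - triangle (diagonal k)))"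
proof -
  let ?d = "diagonal k"
  have "k - triangle ?d \<le> ?d" "triangle ?d \<le> k" using diagonal_bounds[of k] by auto
  then have "prod_encode (k - triangle ?d, ?d - (k - triangle ?d)) = k"
    by (simp add: prod_encode_def)
  then show ?thesis by (metis prod_encode_inverse)
qed

lemma computable_add: "computable f \<Longrightarrow> computable g \<Longrightarrow> computable (\<lambda>x. f x + g x)"
  by (rule computable_bin[OF bin_computable_add])

lemma computable_diff: "computable f \<Longrightarrow> computable g \<Longrightarrow> computable (\<lambda>x. f x - g x)"
  by (rule computable_bin[OF bin_computable_diff])

lemma computable_prod_fst:
  assumes "computable f" shows "computable (\<lambda>x. fst (prod_decode (f x)))"
  unfolding prod_decode_diagonal fst_conv
  by (intro computable_diff computable_comp[OF computable_triangle]
      computable_comp[OF computable_diagonal] assms)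

lemma computable_prod_snd:
  assumes "computable f" shows "computable (\<lambda>x. snd (prod_decode (f x)))"
  unfolding prod_decode_diagonal snd_conv
  by (intro computable_diff computable_comp[OF computable_triangle]
      computable_comp[OF computable_diagonal] assms)

lemma bin_computable_prod_encode: "bin_computable (\<lambda>x y. prod_encode (x, y))"
  unfolding prod_encode_def prod.case
  by (intro bin_computable_comp2[OF bin_computable_add] bin_computable_comp1[OF computable_triangle]
      bin_computable_add bin_computable_fst)

lemma computable_prod_encode:
  "computable f \<Longrightarrow> computable g \<Longrightarrow> computable (\<lambda>x. prod_encode (f x, g x))"
  by (rule computable_bin[OF bin_computable_prod_encode])

text \<open>Parameter, counter and accumulator of the step are packed into a nested pair, so that
  computability of the step can be stated for a unary function.\<close>

lemma computable_rec_nat: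
  assumes "computable b" "computable f"
    and "computable (\<lambda>z. g (fst (prod_decode z)) (fst (prod_decode (snd (prod_decode z))))
                           (snd (prod_decode (snd (prod_decode z)))))"
  shows "computable (\<lambda>x. rec_nat (f x) (\<lambda>k a. g x k a) (b x))"
proof -
  let ?g = "\<lambda>z. g (fst (prod_decode z)) (fst (prod_decode (snd (prod_decode z))))
                           (snd (prod_decode (snd (prod_decode z))))"
  obtain rb where rb: "\<And>x. rec_eval rb [x] (b x)"
    using assms(1) unfolding computable_def by blast
  obtain rf where rf: "\<And>x. rec_eval rf [x] (f x)"
    using assms(2) unfolding computable_def by blast
  obtain rg where rg: "\<And>z. rec_eval rg [z] (?g z)"
    using assms(3) unfolding computable_def by auto
  obtain rp where rp: "\<And>x y. rec_eval rp [x, y] (prod_encode (x, y))"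
    using bin_computable_prod_encode unfolding bin_computable_def by blast
  \<comment> \<open>Primitive recursion supplies the arguments in the order \<open>k\<close>,
    \<open>a\<close>, \<open>x\<close>; hence \<open>Idf 2\<close> fetches the parameter, which
    comes first in the packed triple.\<close>
  define rs where "rs = Cnf rg [Cnf rp [Idf 2, Cnf rp [Idf 0, Idf 1]]]"
  have "rec_eval rs [k, a, x] (g x k a)" for k a x
    using rec_eval_Cn1[OF rec_eval_Cn2[OF rec_eval_Id rec_eval_Cn2[OF rec_eval_Id rec_eval_Id rp] rp] rg,
        of 2 "[k, a, x]" x 0 k 1 a]
    by (simp add: rs_def)
  then have "rec_eval (Prf rf rs) [y, x] (rec_nat (f x) (g x) y)" for x y
    by (intro rec_eval_Pr rf)
  then have "rec_eval (Cnf (Prf rf rs) [rb, Idf 0]) [x] (rec_nat (f x) (g x) (b x))" for x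
    by (intro rec_eval_Cn2[OF rb rec_eval_Id]) auto
  then show ?thesis unfolding computable_def by blast
qed

lemma computable_subst2:
  assumes "computable (\<lambda>z. g (fst (prod_decode z)) (snd (prod_decode z)))" "computable a" "computable b"
  shows "computable (\<lambda>x. g (a x) (b x))"
  using computable_comp[OF assms(1) computable_prod_encode[OF assms(2,3)]] by simp

lemma computable_subst3:
  assumes "computable (\<lambda>z. g (fst (prod_decode z)) (fst (prod_decode (snd (prod_decode z))))
                           (snd (prod_decode (snd (prod_decode z)))))"
    and "computable a" "computable b" "computable c"
  shows "computable (\<lambda>x. g (a x) (b x) (c x))"
  using computable_comp[OF assms(1)
      computable_prod_encode[OF assms(2) computable_prod_encode[OF assms(3,4)]]] by simp

section \<open>Decidable predicates and bounded quantifiers\<close>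

definition decidable :: "(nat \<Rightarrow> bool) \<Rightarrow> bool" where
  "decidable P \<longleftrightarrow> computable (\<lambda>x. of_bool (P x))"

text \<open>A case distinction is a primitive recursion that runs for zero or one step, with the
  truth value as counter.\<close>

lemma computable_if:
  assumes "decidable P" "computable f" "computable g"
  shows "computable (\<lambda>x. if P x then f x else g x)"
proof -
  have eq: "(\<lambda>x. if P x then f x else g x) = (\<lambda>x. rec_nat (g x) (\<lambda>k a. f x) (of_bool (P x)))"
    by auto
  show ?thesis
    unfolding eq using assms unfolding decidable_def
    by (intro computable_rec_nat computable_comp[OF assms(2)] computable_prod_fst computable_id)
qed

lemma decidable_not:
  assumes "decidable P" shows "decidable (\<lambda>x. \<not> P x)"
proof -
  have eq: "(\<lambda>x. of_bool (\<not> P x)) = (\<lambda>x. 1 - of_bool (P x) :: nat)" by auto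
  show ?thesis using assms unfolding decidable_def eq by (intro computable_diff computable_const)
qed

lemma decidable_conj:
  assumes "decidable P" "decidable Q" shows "decidable (\<lambda>x. P x \<and> Q x)"
proof -
  have eq: "(\<lambda>x. of_bool (P x \<and> Q x)) = (\<lambda>x. if P x then of_bool (Q x) else 0 :: nat)" by auto
  show ?thesis using assms(2) unfolding decidable_def eq
    by (intro computable_if computable_const assms)
qed

lemma decidable_imp:
  assumes "decidable P" "decidable Q" shows "decidable (\<lambda>x. P x \<longrightarrow> Q x)"
  using decidable_not[OF decidable_conj[OF assms(1) decidable_not[OF assms(2)]]] by simp

lemma decidable_le:
  assumes "computable f" "computable g" shows "decidable (\<lambda>x. f x \<le> g x)"
proof -
  have eq: "(\<lambda>x. of_bool (f x \<le> g x)) = (\<lambda>x. 1 - (f x - g x))" by (auto simp: fun_eq_iff)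
  show ?thesis unfolding decidable_def eq by (intro computable_diff computable_const assms)
qed

lemma decidable_eq:
  assumes "computable f" "computable g" shows "decidable (\<lambda>x. f x = g x)"
  using decidable_conj[OF decidable_le[OF assms] decidable_le[OF assms(2,1)]]
  by (simp add: eq_iff)

lemma decidable_all_less:
  assumes "computable b"
    and "decidable (\<lambda>z. P (fst (prod_decode z)) (snd (prod_decode z)))"
  shows "decidable (\<lambda>x. \<forall>k<b x. P x k)"
proof -
  have eq: "of_bool (\<forall>k<m. P x k) = rec_nat 1 (\<lambda>k a. if P x k then a else 0) m" for x m
    by (induction m) (auto simp: less_Suc_eq)
  have D: "decidable (\<lambda>z. P (fst (prod_decode z)) (fst (prod_decode (snd (prod_decode z)))))"
    using assms(2) unfolding decidable_def
    by (rule computable_subst2[where g = "\<lambda>x k. of_bool (P x k)"])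
      (intro computable_prod_fst computable_prod_snd computable_id)+
  show ?thesis
    unfolding decidable_def eq
    by (intro computable_rec_nat computable_if D assms computable_const computable_prod_snd computable_id)
qed

lemma decidable_ex_less:
  assumes "computable b"
    and "decidable (\<lambda>z. P (fst (prod_decode z)) (snd (prod_decode z)))"
  shows "decidable (\<lambda>x. \<exists>k<b x. P x k)"
  using decidable_not[OF decidable_all_less[OF assms(1) decidable_not[OF assms(2)]]] by simp

section \<open>Recursion over coded lists\<close>

lemma length_le_list_encode: "length xs \<le> list_encode xs"
proof (induction xs)
  case (Cons x xs)
  then show ?case using le_prod_encode_2[of "list_encode xs" x] by simp
qed simp

text \<open>The recursion state pairs the code of the unread rest with the accumulator. The code of
  the list is itself a sufficient number of iterations, and the state stays fixed once the rest is
  empty. Each \<open>- 1\<close> strips the \<open>Suc\<close> from the code of a nonempty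
  list.\<close>

lemma computable_foldl:
  assumes "computable c" "computable b"
    and "computable (\<lambda>z. g (fst (prod_decode z)) (fst (prod_decode (snd (prod_decode z))))
                           (snd (prod_decode (snd (prod_decode z)))))"
  shows "computable (\<lambda>x. foldl (\<lambda>a e. g x a e) (b x) (list_decode (c x)))"
proof -
  define step where "step x s = (if fst (prod_decode s) = 0 then s
    else prod_encode (snd (prod_decode (fst (prod_decode s) - 1)),
       g x (snd (prod_decode s)) (fst (prod_decode (fst (prod_decode s) - 1)))))" for x s
  have "snd (prod_decode (rec_nat (prod_encode (list_encode xs, a)) (\<lambda>k. step x) m)) = foldl (g x) a xs"
    if "length xs \<le> m" for xs a x m
  proof -
    have "rec_nat (prod_encode (list_encode xs, a)) (\<lambda>k. step x) m
      = prod_encode (list_encode (drop m xs), foldl (g x) a (take m xs))" for m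
    proof (induction m)
      case (Suc m)
      show ?case
      proof (cases "m < length xs")
        case True
        then have "drop m xs = xs ! m # drop (Suc m) xs" "take (Suc m) xs = take m xs @ [xs ! m]"
          by (simp_all add: Cons_nth_drop_Suc take_Suc_conv_app_nth)
        with Suc show ?thesis by (simp add: step_def)
      qed (use Suc in \<open>simp add: step_def\<close>)
    qed simp
    with that show ?thesis by simp
  qed
  from this[OF length_le_list_encode]
  have "(\<lambda>x. foldl (\<lambda>a e. g x a e) (b x) (list_decode (c x)))
     = (\<lambda>x. snd (prod_decode (rec_nat (prod_encode (c x, b x)) (\<lambda>k. step x) (c x))))"
    by (metis list_decode_inverse)
  moreover have "computable (\<lambda>z. g (fst (prod_decode z))
       (snd (prod_decode (snd (prod_decode (snd (prod_decode z))))))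
       (fst (prod_decode (fst (prod_decode (snd (prod_decode (snd (prod_decode z))))) - 1))))"
    by (rule computable_subst3[OF assms(3)])
      (intro computable_prod_fst computable_prod_snd computable_id computable_diff computable_const)+
  ultimately show ?thesis
    unfolding step_def
    by (auto simp del: One_nat_def intro!: computable_prod_encode computable_prod_fst computable_prod_snd
        computable_id computable_diff computable_const computable_rec_nat computable_if decidable_eq assms)
qed

lemmas computable_intros =
  computable_id computable_Suc computable_const computable_add computable_diff
  computable_prod_fst computable_prod_snd computable_prod_encode computable_rec_nat computable_if
  computable_foldl
  decidable_not decidable_conj decidable_imp decidable_le decidable_eq decidable_all_less decidable_ex_less

lemma decidable_mem:
  assumes "computable f" "computable c" shows "decidable (\<lambda>x. f x \<in> set (list_decode (c x)))"
proof -
  have "foldl (\<lambda>a e. if e = y then 1 else a) b xs = (if y \<in> set xs then 1 else b)" for y b :: nat and xs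
    by (induction xs arbitrary: b) auto
  then have eq: "of_bool (y \<in> set xs) = foldl (\<lambda>a e. if e = y then 1 else a) (0::nat) xs" for y :: nat and xs
    by simp
  show ?thesis
    unfolding decidable_def eq by (intro computable_intros assms computable_comp[OF assms(1)])
qed

lemma decidable_all_mem:
  assumes "computable c" "decidable (\<lambda>z. P (fst (prod_decode z)) (snd (prod_decode z)))"
  shows "decidable (\<lambda>x. \<forall>e\<in>set (list_decode (c x)). P x e)"
proof -
  have "foldl (\<lambda>a e. if P x e then a else 0) b xs = (if \<forall>e\<in>set xs. P x e then b else 0)" for x xs and b :: nat
    by (induction xs arbitrary: b) auto
  then have eq: "of_bool (\<forall>e\<in>set xs. P x e) = foldl (\<lambda>a e. if P x e then a else 0) (1::nat) xs" for x xs
    by simp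
  have D: "decidable (\<lambda>z. P (fst (prod_decode z)) (snd (prod_decode (snd (prod_decode z)))))"
    using assms(2) unfolding decidable_def
    by (rule computable_subst2[where g = "\<lambda>x k. of_bool (P x k)"])
      (intro computable_prod_fst computable_prod_snd computable_id)+
  show ?thesis
    unfolding decidable_def eq by (intro computable_intros D assms)
qed

lemma computable_length:
  assumes "computable c" shows "computable (\<lambda>x. length (list_decode (c x)))"
proof -
  have "foldl (\<lambda>a e. Suc a) b xs = b + length xs" for b and xs :: "nat list"
    by (induction xs arbitrary: b) auto
  then have eq: "length xs = foldl (\<lambda>a e. Suc a) 0 xs" for xs :: "nat list" by simp
  show ?thesis unfolding eq by (intro computable_intros assms)
qed

section \<open>Pairs of deterministic two-tape automata\<close>

fun run :: "(nat \<times> nat \<times> nat) set \<Rightarrow> nat \<Rightarrow> nat list \<Rightarrow> nat \<Rightarrow> bool" where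
  "run T p [] q \<longleftrightarrow> p = q"
| "run T p (m # u) q \<longleftrightarrow> (\<exists>r. (p, m, r) \<in> T \<and> run T r u q)"

lemma run_append: "run T p (u @ v) q \<longleftrightarrow> (\<exists>r. run T p u r \<and> run T r v q)"
  by (induction u arbitrary: p) auto

text \<open>The complement of \<open>A\<close> stands for the second alphabet, so exchanging the
  machines amounts to complementing \<open>A\<close>.\<close>

definition same_proj :: "nat set \<Rightarrow> nat list \<Rightarrow> nat list \<Rightarrow> bool" where
  "same_proj A u v \<longleftrightarrow> filter (\<lambda>m. m \<in> A) u = filter (\<lambda>m. m \<in> A) v
     \<and> filter (\<lambda>m. m \<notin> A) u = filter (\<lambda>m. m \<notin> A) v"

lemma same_proj_sym: "same_proj A u v \<Longrightarrow> same_proj A v u"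
  unfolding same_proj_def by simp

lemma same_proj_Compl [simp]: "same_proj (- A) u v \<longleftrightarrow> same_proj A u v"
  unfolding same_proj_def by auto

lemma same_proj_length: "same_proj A u v \<Longrightarrow> length u = length v"
  unfolding same_proj_def
  using sum_length_filter_compl[of "\<lambda>m. m \<in> A" u] sum_length_filter_compl[of "\<lambda>m. m \<in> A" v] by metis

definition deterministic :: "(nat \<times> nat \<times> nat) set \<Rightarrow> bool" where
  "deterministic T \<longleftrightarrow> (\<forall>p m q q'. (p, m, q) \<in> T \<longrightarrow> (p, m, q') \<in> T \<longrightarrow> q = q')"

text \<open>This is what remains of the send/receive dichotomy of states once signs are erased: each
  state reads one tape only.\<close>

definition one_sided :: "nat set \<Rightarrow> (nat \<times> nat \<times> nat) set \<Rightarrow> bool" where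
  "one_sided A T \<longleftrightarrow> (\<forall>p m q m' q'. (p, m, q) \<in> T \<longrightarrow> (p, m', q') \<in> T \<longrightarrow> (m \<in> A \<longleftrightarrow> m' \<in> A))"

text \<open>The state fixes the tape read next, the tape fixes the symbol, and determinism fixes the
  successor. So a run is determined by its two projections, and the prefix relation on both tapes
  lifts to the runs.\<close>

lemma run_prefix_of_proj_prefix:
  assumes "deterministic T" "one_sided A T" "run T p u q" "run T p v r"
    and "filter (\<lambda>m. m \<in> A) v = filter (\<lambda>m. m \<in> A) u @ a"
    and "filter (\<lambda>m. m \<notin> A) v = filter (\<lambda>m. m \<notin> A) u @ b"
  shows "\<exists>t. v = u @ t \<and> run T q t r"
  using assms(3-)
proof (induction u arbitrary: p v)
  case (Cons m u)
  obtain m' v' where v: "v = m' # v'"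
    using Cons.prems(3,4) by (cases v) (auto split: if_splits)
  obtain s s' where s: "(p, m, s) \<in> T" "run T s u q" "(p, m', s') \<in> T" "run T s' v' r"
    using Cons.prems v by auto
  have "m \<in> A \<longleftrightarrow> m' \<in> A" using assms(2) s unfolding one_sided_def by blast
  then have "m' = m" using Cons.prems(3,4) v by (auto split: if_splits)
  moreover from this have "s' = s" using s assms(1) unfolding deterministic_def by blast
  ultimately show ?case
    using Cons.IH[of s v'] s Cons.prems(3,4) v by (auto split: if_splits)
qed auto

text \<open>\<open>v\<close> is read greedily until the next symbol belongs to a tape whose share,
  \<open>x\<close> or \<open>y\<close>, is used up; that share then has no remainder.\<close>

lemma proj_prefix_split:
  assumes "filter P w = x @ a" "filter (\<lambda>m. \<not> P m) w = y @ b"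
  shows "\<exists>v t x' y'. w = v @ t \<and> x = filter P v @ x' \<and> y = filter (\<lambda>m. \<not> P m) v @ y' \<and> (x' = [] \<or> y' = [])"
  using assms
proof (induction w arbitrary: x y)
  case (Cons m w)
  show ?case
  proof (cases "if P m then x = [] else y = []")
    case True
    then show ?thesis
      by (intro exI[of _ "[]"] exI[of _ "m # w"] exI[of _ x] exI[of _ y]) (simp split: if_splits)
  next
    case False
    then obtain x1 y1 where "filter P w = x1 @ a" "filter (\<lambda>m. \<not> P m) w = y1 @ b"
      and xy: "if P m then x = m # x1 \<and> y = y1 else x = x1 \<and> y = m # y1"
      using Cons.prems by (cases "P m"; cases x; cases y) (auto split: if_splits)
    from Cons.IH[OF this(1,2)] obtain v t x' y' where "w = v @ t" "x1 = filter P v @ x'"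
      "y1 = filter (\<lambda>m. \<not> P m) v @ y'" "x' = [] \<or> y' = []" by blast
    then show ?thesis
      using xy by (intro exI[of _ "m # v"] exI[of _ t] exI[of _ x'] exI[of _ y']) (auto split: if_splits)
  qed
qed auto

text \<open>The symbols violating \<open>P\<close> separate at most one block more than their own
  number, and each block has length at most \<open>k\<close>.\<close>

lemma length_filter_le_of_blocks:
  assumes "\<And>xs ys zs. t = xs @ ys @ zs \<Longrightarrow> \<forall>m\<in>set ys. P m \<Longrightarrow> length ys \<le> k"
  shows "length (filter P t) \<le> Suc (length (filter (\<lambda>m. \<not> P m) t)) * k"
  using assms
proof (induction t rule: length_induct)
  case (1 t)
  obtain ys r where t: "t = ys @ r" and P: "\<forall>m\<in>set ys. P m" and r: "r = [] \<or> \<not> P (hd r)"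
    using takeWhile_dropWhile_id[of P t] set_takeWhileD[of _ P t] hd_dropWhile[of P t] by metis
  have ys: "length ys \<le> k"
    using 1(2)[of "[]" ys r] t P by simp
  have f: "filter P ys = ys" "filter (\<lambda>m. \<not> P m) ys = []"
    using P by (auto simp: filter_id_conv filter_empty_conv)
  show ?case
  proof (cases r)
    case Nil
    then show ?thesis using ys t f by simp
  next
    case (Cons m r')
    have "length ys' \<le> k" if "r' = xs @ ys' @ zs" "\<forall>m\<in>set ys'. P m" for xs ys' zs
      using 1(2)[of "ys @ m # xs" ys' zs] t Cons that by simp
    then have "length (filter P r') \<le> Suc (length (filter (\<lambda>m. \<not> P m) r')) * k"
      using 1(1)[rule_format, of r'] t Cons by simp
    moreover have "filter P t = ys @ filter P r'" "filter (\<lambda>m. \<not> P m) t = m # filter (\<lambda>m. \<not> P m) r'"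
      using t Cons r f by auto
    ultimately show ?thesis using ys by simp
  qed
qed

lemma run_length_filter_le:
  assumes "\<And>p u q. run T p u q \<Longrightarrow> \<forall>m\<in>set u. P m \<Longrightarrow> length u \<le> k" "run T p t q"
  shows "length (filter P t) \<le> Suc (length (filter (\<lambda>m. \<not> P m) t)) * k"
  by (rule length_filter_le_of_blocks) (use assms in \<open>auto simp: run_append\<close>)


section \<open>Bounded lag and pumping\<close>

locale machine =
  fixes A :: "nat set" and T :: "(nat \<times> nat \<times> nat) set" and h :: nat and S :: "nat set" and n :: nat
  assumes det: "deterministic T" and one_sided: "one_sided A T"
    and trans_in: "(p, m, q) \<in> T \<Longrightarrow> p \<in> S \<and> q \<in> S \<and> m \<le> n"
    and init_in: "h \<in> S" and states_le: "p \<in> S \<Longrightarrow> p \<le> n"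
    and connected: "p \<in> S \<Longrightarrow> q \<in> S \<Longrightarrow> \<exists>s. length s \<le> n \<and> run T p s q"
begin

lemma run_in: "run T p u q \<Longrightarrow> p \<in> S \<Longrightarrow> q \<in> S"
  by (induction u arbitrary: p) (auto dest: trans_in)

lemma run_symbols_le: "run T p u q \<Longrightarrow> m \<in> set u \<Longrightarrow> m \<le> n"
  by (induction u arbitrary: p) (auto dest: trans_in)

end

text \<open>A block closed to a loop by two connecting paths of length at most \<open>n\<close>
  leaves at most \<open>2 * n\<close> symbols on the other tape. A matching loop of the first
  machine thus has at most \<open>Suc (2 * n)\<close> blocks of sends, each of length at most
  \<open>n\<close>.\<close>

definition block_bound :: "nat \<Rightarrow> nat" where
  "block_bound n = Suc (2 * n) * n"

text \<open>When one tape is read up, only the closing path contributes to it, with at most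
  \<open>n\<close> symbols. These leave at most \<open>Suc n\<close> blocks on the other
  tape.\<close>

definition lag_bound :: "nat \<Rightarrow> nat" where
  "lag_bound n = Suc n * block_bound n"

text \<open>This is the code of the list of \<open>k\<close> entries \<open>n\<close>, the largest
  code of a list of at most \<open>k\<close> entries none of which exceeds \<open>n\<close>.\<close>

definition list_bound :: "nat \<Rightarrow> nat \<Rightarrow> nat" where
  "list_bound n k = rec_nat 0 (\<lambda>_ a. Suc (prod_encode (n, a))) k"

text \<open>Configurations are not counted; their largest code is used instead. The components are
  the two states and the two unread words.\<close>

definition config_bound :: "nat \<Rightarrow> nat" where
  "config_bound n = prod_encode (n, prod_encode (n, prod_encode
     (list_bound n (lag_bound n), list_bound n (lag_bound n))))"

text \<open>Two demands are added up: loops of length \<open>block_bound n + 2 * n + 1\<close> must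
  be covered, and in any longer run a prefix of length \<open>config_bound n + 1\<close> followed by
  a closing path of length \<open>n\<close> must still be shorter than the run.\<close>

definition witness_bound :: "nat \<Rightarrow> nat" where
  "witness_bound n = config_bound n + block_bound n + 2 * n + 2"

lemma prod_encode_mono: "a \<le> c \<Longrightarrow> b \<le> d \<Longrightarrow> prod_encode (a, b) \<le> prod_encode (c, d)"
proof -
  assume "a \<le> c" "b \<le> d"
  moreover have "mono triangle" by (rule mono_iff_le_Suc[THEN iffD2]) simp
  ultimately show ?thesis
    unfolding prod_encode_def by (auto intro!: add_mono dest!: monoD[of _ "a + b" "c + d"])
qed

lemma list_encode_le_list_bound:
  "length xs \<le> k \<Longrightarrow> \<forall>x\<in>set xs. x \<le> n \<Longrightarrow> list_encode xs \<le> list_bound n k"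
proof (induction xs arbitrary: k)
  case (Cons x xs)
  then obtain j where "k = Suc j" "length xs \<le> j" by (cases k) auto
  with Cons show ?case by (auto simp: list_bound_def intro!: prod_encode_mono)
qed simp

text \<open>\<open>A\<close> holds the messages sent by the first machine. The two assumptions are
  the quantitative form of the absence of send cycles; a bound on blocks of receives has to be
  derived.\<close>

locale machine_pair =
  F: machine A T0 h0 S0 n + G: machine A T1 h1 S1 n
  for A T0 h0 S0 T1 h1 S1 n +
  assumes sends0: "run T0 p u q \<Longrightarrow> \<forall>m\<in>set u. m \<in> A \<Longrightarrow> length u \<le> n"
    and sends1: "run T1 p u q \<Longrightarrow> \<forall>m\<in>set u. m \<notin> A \<Longrightarrow> length u \<le> n"
begin

definition simulated :: "nat list \<Rightarrow> nat \<Rightarrow> bool" where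
  "simulated u r \<longleftrightarrow> (\<exists>v. same_proj A u v \<and> run T1 h1 v r)"

text \<open>A long block of receives of the second machine would be part of a loop in which the first
  machine sends a lot but receives little.\<close>
lemma receives1:
  assumes loops: "\<And>v. length v \<le> witness_bound n \<Longrightarrow> run T1 h1 v h1 \<Longrightarrow> \<exists>u. same_proj A u v \<and> run T0 h0 u h0"
    and v: "run T1 p v q" "\<forall>m\<in>set v. m \<in> A"
  shows "length v \<le> block_bound n"
proof (rule ccontr)
  assume long: "\<not> length v \<le> block_bound n"
  \<comment> \<open>The block is cut to one symbol above the bound, so that the loop through it
    stays within \<open>witness_bound n\<close> and \<open>loops\<close> applies.\<close>
  define x where "x = take (Suc (block_bound n)) v"
  have lx: "length x = Suc (block_bound n)" using long by (simp add: x_def)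
  have xA: "\<forall>m\<in>set x. m \<in> A" using v(2) by (auto simp: x_def dest: in_set_takeD)
  obtain r where r: "run T1 p x r"
    using v(1) run_append[of T1 p x "drop (Suc (block_bound n)) v" q] by (auto simp: x_def)
  have "p \<in> S1" using r lx G.trans_in by (cases x) auto
  then have "r \<in> S1" using G.run_in r by blast
  obtain s where s: "length s \<le> n" "run T1 h1 s p" using G.connected[OF G.init_in \<open>p \<in> S1\<close>] by blast
  obtain s' where s': "length s' \<le> n" "run T1 r s' h1" using G.connected[OF \<open>r \<in> S1\<close> G.init_in] by blast
  have "run T1 h1 (s @ x @ s') h1" using s s' r by (auto simp: run_append)
  moreover have "length (s @ x @ s') \<le> witness_bound n" using s s' lx by (simp add: witness_bound_def)
  ultimately obtain u where u: "same_proj A u (s @ x @ s')" "run T0 h0 u h0" using loops by blast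
  have "length (filter (\<lambda>m. m \<in> A) u) \<le> Suc (length (filter (\<lambda>m. m \<notin> A) u)) * n"
    by (rule run_length_filter_le[OF sends0 u(2)])
  moreover have "filter (\<lambda>m. m \<notin> A) u = filter (\<lambda>m. m \<notin> A) s @ filter (\<lambda>m. m \<notin> A) s'"
    using u(1) xA unfolding same_proj_def by (simp add: filter_empty_conv)
  then have "length (filter (\<lambda>m. m \<notin> A) u) \<le> 2 * n"
    using add_mono[OF le_trans[OF length_filter_le s(1)] le_trans[OF length_filter_le s'(1)]] by (simp add: mult_2)
  then have "Suc (length (filter (\<lambda>m. m \<notin> A) u)) * n \<le> block_bound n"
    unfolding block_bound_def by (intro mult_le_mono1) simp
  moreover have "filter (\<lambda>m. m \<in> A) x = x" using xA by (simp add: filter_id_conv)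
  then have "length (filter (\<lambda>m. m \<in> A) u) \<ge> length x"
    using u(1) unfolding same_proj_def by simp
  ultimately show False using lx by simp
qed

text \<open>With the end state of \<open>u\<close>, the data \<open>p\<close>, \<open>x\<close>,
  \<open>y\<close> form the configuration used for pumping. The second machine has not read beyond
  \<open>u\<close> on either tape.\<close>

definition follows :: "nat list \<Rightarrow> nat \<Rightarrow> nat list \<Rightarrow> nat list \<Rightarrow> bool" where
  "follows u p x y \<longleftrightarrow> (\<exists>v. run T1 h1 v p \<and> filter (\<lambda>m. m \<in> A) u = filter (\<lambda>m. m \<in> A) v @ x
     \<and> filter (\<lambda>m. m \<notin> A) u = filter (\<lambda>m. m \<notin> A) v @ y)"

text \<open>Here \<open>s\<close> is the path closing \<open>u\<close> to a loop. The matching loop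
  \<open>w\<close> is stopped when it would read past \<open>u\<close> on some tape. Its rest then
  meets only symbols of \<open>s\<close> on that tape, so it has few blocks on the other; those in
  \<open>A\<close> are short by \<open>receives1\<close>, those outside by
  \<open>sends1\<close>.\<close>

lemma bounded_lag:
  assumes loops: "\<And>v. length v \<le> witness_bound n \<Longrightarrow> run T1 h1 v h1 \<Longrightarrow> \<exists>u. same_proj A u v \<and> run T0 h0 u h0"
    and s: "length s \<le> n" "simulated (u @ s) h1"
  shows "\<exists>p x y. follows u p x y \<and> length x \<le> lag_bound n \<and> length y \<le> lag_bound n"
proof -
  let ?a = "filter (\<lambda>m. m \<in> A)" and ?b = "filter (\<lambda>m. m \<notin> A)"
  obtain w where w: "same_proj A (u @ s) w" "run T1 h1 w h1"
    using s(2) unfolding simulated_def by blast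
  then have "?a w = ?a u @ ?a s" "?b w = ?b u @ ?b s" unfolding same_proj_def by auto
  from proj_prefix_split[OF this] obtain v t x y where
    wvt: "w = v @ t" and x: "?a u = ?a v @ x" and y: "?b u = ?b v @ y" and xy: "x = [] \<or> y = []"
    by blast
  obtain p where p: "run T1 h1 v p" "run T1 p t h1" using w(2) wvt by (auto simp: run_append)
  have t: "?a t = x @ ?a s" "?b t = y @ ?b s" using w(1) wvt x y unfolding same_proj_def by auto
  have ls: "length (?a s) \<le> n" "length (?b s) \<le> n"
    using s(1) length_filter_le le_trans by blast+
  have "length (?a t) \<le> Suc (length (?b t)) * block_bound n"
    by (rule run_length_filter_le[OF receives1[OF loops] p(2)])
  moreover have "length (?b t) \<le> Suc (length (?a t)) * n"
    using run_length_filter_le[where P = "\<lambda>m. m \<notin> A", OF sends1 p(2)] by simp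
  moreover have "Suc k * n \<le> lag_bound n" "Suc k * block_bound n \<le> lag_bound n" if "k \<le> n" for k
    unfolding lag_bound_def block_bound_def using that by (intro mult_le_mono; simp)+
  ultimately have "y = [] \<longrightarrow> length (?a t) \<le> lag_bound n" "x = [] \<longrightarrow> length (?b t) \<le> lag_bound n"
    using t ls by (auto intro: le_trans)
  then have "length x \<le> lag_bound n \<and> length y \<le> lag_bound n"
    using xy t by auto
  then show ?thesis using p(1) x y unfolding follows_def by blast
qed

text \<open>The run matching \<open>u @ z\<close> must extend \<open>v\<close>, since runs are
  determined by their projections. The extension consumes exactly \<open>x\<close>, \<open>y\<close>
  and \<open>z\<close>, so it can be grafted onto \<open>v'\<close>.\<close>

lemma simulated_transfer:
  assumes "follows u p x y" "follows u' p x y" "simulated (u @ z) r"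
  shows "simulated (u' @ z) r"
proof -
  let ?a = "filter (\<lambda>m. m \<in> A)" and ?b = "filter (\<lambda>m. m \<notin> A)"
  obtain v where v: "run T1 h1 v p" "?a u = ?a v @ x" "?b u = ?b v @ y"
    using assms(1) unfolding follows_def by blast
  obtain v' where v': "run T1 h1 v' p" "?a u' = ?a v' @ x" "?b u' = ?b v' @ y"
    using assms(2) unfolding follows_def by blast
  obtain w where w: "same_proj A (u @ z) w" "run T1 h1 w r"
    using assms(3) unfolding simulated_def by blast
  have "?a w = ?a v @ (x @ ?a z)" "?b w = ?b v @ (y @ ?b z)"
    using w(1) v unfolding same_proj_def by auto
  from run_prefix_of_proj_prefix[OF G.det G.one_sided v(1) w(2) this]
  obtain t where t: "w = v @ t" "run T1 p t r" by blast
  then have "same_proj A (u' @ z) (v' @ t)"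
    using w(1) v v' unfolding same_proj_def by auto
  moreover have "run T1 h1 (v' @ t) r" using v'(1) t(2) by (auto simp: run_append)
  ultimately show ?thesis unfolding simulated_def by blast
qed

text \<open>A short prefix of \<open>u\<close>, closed to a loop, is still shorter than
  \<open>u\<close>; so \<open>shorter\<close> applies and the lag after that prefix is bounded.
  There are more such prefixes than configurations, and the segment between two prefixes with equal
  configurations is removed.\<close>

lemma pump:
  assumes loops: "\<And>v. length v \<le> witness_bound n \<Longrightarrow> run T1 h1 v h1 \<Longrightarrow> \<exists>u. same_proj A u v \<and> run T0 h0 u h0"
    and shorter: "\<And>u'. length u' < length u \<Longrightarrow> run T0 h0 u' h0 \<Longrightarrow> simulated u' h1"
    and u: "run T0 h0 u q" "witness_bound n < length u"
  shows "\<exists>u'. length u' < length u \<and> run T0 h0 u' q \<and> (\<forall>r. simulated u' r \<longleftrightarrow> simulated u r)"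
proof -
  let ?M = "config_bound n"
  have "\<exists>p0 p x y. run T0 h0 (take i u) p0 \<and> run T0 p0 (drop i u) q \<and> follows (take i u) p x y
      \<and> length x \<le> lag_bound n \<and> length y \<le> lag_bound n" if "i \<le> Suc ?M" for i
  proof -
    obtain p0 where p0: "run T0 h0 (take i u) p0" "run T0 p0 (drop i u) q"
      using u(1) run_append[of T0 h0 "take i u" "drop i u"] by auto
    then obtain s where s: "length s \<le> n" "run T0 p0 s h0"
      using F.connected F.init_in F.run_in by blast
    have "run T0 h0 (take i u @ s) h0" using p0 s by (auto simp: run_append)
    moreover have "length (take i u @ s) < length u"
      using s(1) that u(2) by (simp add: witness_bound_def)
    ultimately have "simulated (take i u @ s) h1" by (rule shorter[rotated])
    from bounded_lag[OF loops s(1) this] p0 show ?thesis by blast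
  qed
  then have "\<forall>i. \<exists>p0 p x y. i \<le> Suc ?M \<longrightarrow> run T0 h0 (take i u) p0 \<and> run T0 p0 (drop i u) q
      \<and> follows (take i u) p x y \<and> length x \<le> lag_bound n \<and> length y \<le> lag_bound n" by blast
  then obtain P0 P X Y where c: "\<And>i. i \<le> Suc ?M \<Longrightarrow> run T0 h0 (take i u) (P0 i) \<and>
      run T0 (P0 i) (drop i u) q \<and> follows (take i u) (P i) (X i) (Y i)
      \<and> length (X i) \<le> lag_bound n \<and> length (Y i) \<le> lag_bound n"
    unfolding choice_iff by auto
  define code where "code i = prod_encode (P0 i, prod_encode (P i, prod_encode
     (list_encode (X i), list_encode (Y i))))" for i
  have "code i \<le> ?M" if "i \<le> Suc ?M" for i
  proof -
    note ci = c[OF that]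
    have "P0 i \<le> n" using ci F.run_in F.init_in F.states_le by blast
    moreover have "P i \<le> n"
      using ci G.run_in G.init_in G.states_le unfolding follows_def by blast
    moreover have "\<forall>m\<in>set u. m \<le> n" using F.run_symbols_le u(1) by blast
    then have "\<forall>m\<in>set (take i u). m \<le> n" by (meson in_set_takeD)
    then have "\<forall>m\<in>set (filter Q (take i u)). m \<le> n" for Q by simp
    then have "\<forall>m\<in>set (X i). m \<le> n" "\<forall>m\<in>set (Y i). m \<le> n"
      using ci unfolding follows_def by (metis Un_iff set_append)+
    ultimately show ?thesis
      using ci unfolding code_def config_bound_def by (intro prod_encode_mono list_encode_le_list_bound) auto
  qed
  \<comment> \<open>There are \<open>?M + 2\<close> prefixes, the empty one included, but only
    \<open>?M + 1\<close> possible codes.\<close>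
  then have "code ` {..Suc ?M} \<subseteq> {..?M}" by auto
  then have "card (code ` {..Suc ?M}) < card {..Suc ?M}"
    by (metis card_atMost card_mono finite_atMost le_imp_less_Suc)
  then have "\<not> inj_on code {..Suc ?M}" by (rule pigeonhole)
  then obtain i j where ij: "i < j" "j \<le> Suc ?M" "code i = code j"
    unfolding inj_on_def by (metis atMost_iff linorder_neqE_nat)
  then have eq: "P0 j = P0 i" "P j = P i" "X j = X i" "Y j = Y i"
    unfolding code_def by (auto simp: list_encode_eq)
  let ?u = "take i u @ drop j u"
  have ci: "run T0 h0 (take i u) (P0 i)" "follows (take i u) (P i) (X i) (Y i)"
    using c[of i] ij by auto
  have cj: "run T0 (P0 i) (drop j u) q" "follows (take j u) (P i) (X i) (Y i)"
    using c[OF ij(2)] eq by auto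
  have "length ?u < length u" using ij u(2) by (simp add: witness_bound_def)
  moreover have "run T0 h0 ?u q" using ci cj by (auto simp: run_append)
  moreover have "simulated ?u r \<longleftrightarrow> simulated u r" for r
    using simulated_transfer[OF ci(2) cj(2), of "drop j u" r]
      simulated_transfer[OF cj(2) ci(2), of "drop j u" r] by auto
  ultimately show ?thesis by blast
qed

text \<open>The induction hypothesis is exactly what \<open>pump\<close> demands of shorter loops.
  The relation \<open>R\<close> is left open to carry the deadlock condition along with the loop
  condition.\<close>

theorem short_witness:
  assumes loops1: "\<And>v. length v \<le> witness_bound n \<Longrightarrow> run T1 h1 v h1 \<Longrightarrow> \<exists>u. same_proj A u v \<and> run T0 h0 u h0"
    and loops0: "\<And>u. length u \<le> witness_bound n \<Longrightarrow> run T0 h0 u h0 \<Longrightarrow> simulated u h1"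
    and ends: "\<And>u q r. length u \<le> witness_bound n \<Longrightarrow> run T0 h0 u q \<Longrightarrow> simulated u r \<Longrightarrow> R q r"
    and "run T0 h0 u q"
  shows "(q = h0 \<longrightarrow> simulated u h1) \<and> (\<forall>r. simulated u r \<longrightarrow> R q r)"
  using \<open>run T0 h0 u q\<close>
proof (induction u arbitrary: q rule: length_induct)
  case (1 u)
  show ?case
  proof (cases "length u \<le> witness_bound n")
    case True
    then show ?thesis using loops0 ends 1(2) by blast
  next
    case False
    have "simulated u' h1" if "length u' < length u" "run T0 h0 u' h0" for u'
      using 1(1) that by blast
    from pump[OF loops1 this 1(2)] False obtain u' where
      "length u' < length u" "run T0 h0 u' q" "\<And>r. simulated u' r \<longleftrightarrow> simulated u r"
      by auto
    then show ?thesis using 1(1) by blast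
  qed
qed

end

text \<open>After the exchange, the sends of the new first machine are the symbols outside
  \<open>A\<close>. This makes the pumping argument available for the other inclusion.\<close>

lemma machine_pair_swap:
  assumes "machine_pair A T0 h0 S0 T1 h1 S1 n"
  shows "machine_pair (- A) T1 h1 S1 T0 h0 S0 n"
proof -
  interpret machine_pair A T0 h0 S0 T1 h1 S1 n by fact
  have "one_sided (- A) T0" "one_sided (- A) T1"
    using F.one_sided G.one_sided unfolding one_sided_def by (meson ComplI ComplD)+
  then show ?thesis
    by (intro machine_pair.intro machine.intro machine_pair_axioms.intro)
      (simp_all add: F.det G.det F.trans_in G.trans_in F.init_in G.init_in F.states_le G.states_le
        F.connected G.connected sends0 sends1)
qed

section \<open>Protocols as pairs of two-tape automata\<close>

text \<open>Dropping signs is harmless for an \<open>sr_pair\<close>: the alphabets are disjoint, so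
  in each machine the message determines whether it is sent or received.\<close>

definition msg_trans :: "fsm \<Rightarrow> (nat \<times> nat \<times> nat) set" where
  "msg_trans F = (\<lambda>(p, e, q). (p, msg e, q)) ` set (trans F)"

lemma msg_trans_iff: "(p, m, q) \<in> msg_trans F \<longleftrightarrow> (\<exists>e. (p, e, q) \<in> set (trans F) \<and> msg e = m)"
  unfolding msg_trans_def by force

lemma path_run: "path F p w q \<Longrightarrow> run (msg_trans F) p (map msg w) q"
  by (induction rule: path.induct) (auto simp: msg_trans_iff)

lemma run_path: "run (msg_trans F) p u q \<Longrightarrow> \<exists>w. path F p w q \<and> map msg w = u"
proof (induction u arbitrary: p)
  case (Cons m u)
  then obtain r e w where "(p, e, r) \<in> set (trans F)" "msg e = m" "path F r w q" "map msg w = u"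
    by (auto simp: msg_trans_iff) metis
  then show ?case by (intro exI[of _ "e # w"]) (auto intro: path.intros)
qed (auto intro: path.intros)

lemma relpow_edges_run: "(p, q) \<in> edges F ^^ k \<Longrightarrow> \<exists>s. length s = k \<and> run (msg_trans F) p s q"
proof (induction k arbitrary: p)
  case (Suc k)
  then obtain r where "(p, r) \<in> edges F" "(r, q) \<in> edges F ^^ k" by (meson relpow_Suc_D2)
  then obtain e s where "(p, e, r) \<in> set (trans F)" "length s = k" "run (msg_trans F) r s q"
    using Suc.IH unfolding edges_def by blast
  then show ?case by (intro exI[of _ "msg e # s"]) (auto simp: msg_trans_iff)
qed simp

lemma run_relpow_send_edges:
  "run (msg_trans F) p u q \<Longrightarrow>
   (\<And>p e q. (p, e, q) \<in> set (trans F) \<Longrightarrow> msg e \<in> set u \<Longrightarrow> is_send e) \<Longrightarrow>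
   (p, q) \<in> send_edges F ^^ length u"
proof (induction u arbitrary: p)
  case (Cons m u)
  then obtain r e where r: "(p, e, r) \<in> set (trans F)" "msg e = m" "run (msg_trans F) r u q"
    by (auto simp: msg_trans_iff)
  then have "is_send e" using Cons.prems(2)[OF r(1)] by simp
  then have "(p, r) \<in> send_edges F" using r(1) unfolding send_edges_def by (cases e) auto
  moreover have "(r, q) \<in> send_edges F ^^ length u"
    using Cons.IH[OF r(3)] Cons.prems(2) by simp
  ultimately show ?case using relpow_Suc_I2 by fastforce
qed simp

lemma finite_edges: "finite (edges F)" "card (edges F) \<le> length (trans F)"
proof -
  have e: "edges F = (\<lambda>(p, e, q). (p, q)) ` set (trans F)" unfolding edges_def by force
  show "finite (edges F)" unfolding e by simp
  show "card (edges F) \<le> length (trans F)"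
    unfolding e by (meson card_image_le card_length finite_set le_trans)
qed

lemma send_edges_subset: "send_edges F \<subseteq> edges F"
  unfolding send_edges_def edges_def by blast

text \<open>A walk with more steps than there are edges uses some edge twice, and the stretch
  between the two uses is a cycle.\<close>

lemma relpow_cycle:
  assumes "finite R" "(p, q) \<in> R ^^ k" "card R < k"
  shows "\<exists>x. (x, x) \<in> R\<^sup>+"
proof -
  obtain f where f: "\<forall>i<k. (f i, f (Suc i)) \<in> R"
    using assms(2) unfolding relpow_fun_conv by blast
  have "(\<lambda>i. (f i, f (Suc i))) ` {..<k} \<subseteq> R" using f by auto
  then have "card ((\<lambda>i. (f i, f (Suc i))) ` {..<k}) < card {..<k}"
    using card_mono[OF assms(1)] assms(3) by (metis card_lessThan le_less_trans)
  then have "\<not> inj_on (\<lambda>i. (f i, f (Suc i))) {..<k}" by (rule pigeonhole)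
  then obtain i j where "i < j" "j < k" "f i = f j"
    unfolding inj_on_def by (metis lessThan_iff linorder_neqE_nat prod.inject)
  have "(f i, f (i + Suc d)) \<in> R\<^sup>+" if "i + d < k" for d
    using that
  proof (induction d)
    case (Suc d)
    then show ?case using f by (auto intro: trancl_into_trancl)
  qed (use f in auto)
  moreover have "i + (j - Suc i) < k" "i + Suc (j - Suc i) = j" using \<open>i < j\<close> \<open>j < k\<close> by auto
  ultimately have "(f j, f j) \<in> R\<^sup>+" using \<open>f i = f j\<close> by metis
  then show ?thesis by blast
qed

lemma run_sends_length_le:
  assumes "\<not> has_send_cycle F" "length (trans F) \<le> n" "run (msg_trans F) p u q"
    and "\<And>p e q. (p, e, q) \<in> set (trans F) \<Longrightarrow> msg e \<in> set u \<Longrightarrow> is_send e"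
  shows "length u \<le> n"
proof (rule ccontr)
  assume "\<not> length u \<le> n"
  moreover have "card (send_edges F) \<le> n"
    using card_mono[OF finite_edges(1) send_edges_subset] finite_edges(2) assms(2) le_trans by blast
  ultimately have "card (send_edges F) < length u" by simp
  from relpow_cycle[OF finite_subset[OF send_edges_subset finite_edges(1)] _ this]
    run_relpow_send_edges[of F p u q] assms
  show False unfolding has_send_cycle_def by auto
qed

text \<open>Injectivity of \<open>msg\<close> on \<open>Sig\<close> preserves determinism when signs
  are dropped, and the dichotomy of states becomes \<open>one_sided\<close>. Strong connectivity
  over finitely many edges gives paths of at most as many steps as there are edges.\<close>

lemma sr_machine_imp_machine:
  assumes sr: "sr_machine Sig F" and inj: "inj_on msg Sig"
    and sides: "\<And>e e'. e \<in> Sig \<Longrightarrow> e' \<in> Sig \<Longrightarrow> is_send e = is_send e' \<Longrightarrow> msg e \<in> A \<longleftrightarrow> msg e' \<in> A"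
    and le: "\<And>e. e \<in> Sig \<Longrightarrow> msg e \<le> n" "\<And>p. p \<in> set (states F) \<Longrightarrow> p \<le> n" "length (trans F) \<le> n"
  shows "machine A (msg_trans F) (initial F) (set (states F)) n"
proof
  have tr: "p \<in> set (states F) \<and> q \<in> set (states F) \<and> e \<in> Sig" if "(p, e, q) \<in> set (trans F)" for p e q
    using sr that unfolding sr_machine_def wf_fsm_def by fastforce
  show "deterministic (msg_trans F)"
    unfolding deterministic_def msg_trans_iff
  proof (intro allI impI, elim exE conjE)
    fix p m q q' e e'
    assume a: "(p, e, q) \<in> set (trans F)" "msg e = m" "(p, e', q') \<in> set (trans F)" "msg e' = m"
    then have "e = e'" using inj tr by (metis inj_onD)
    then show "q = q'" using sr a unfolding sr_machine_def by blast
  qed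
  show "one_sided A (msg_trans F)"
    unfolding one_sided_def msg_trans_iff
  proof (intro allI impI, elim exE conjE)
    fix p m q m' q' e e'
    assume a: "(p, e, q) \<in> set (trans F)" "msg e = m" "(p, e', q') \<in> set (trans F)" "msg e' = m'"
    then have "send_state F p \<or> receive_state F p" using sr tr unfolding sr_machine_def by blast
    then have "is_send e = is_send e'"
      using a unfolding send_state_def receive_state_def by (cases e; cases e') auto
    then show "(m \<in> A) = (m' \<in> A)" using sides a tr by metis
  qed
  show "p \<in> set (states F) \<and> q \<in> set (states F) \<and> m \<le> n" if "(p, m, q) \<in> msg_trans F" for p m q
    using that tr le(1) unfolding msg_trans_iff by blast
  show "initial F \<in> set (states F)" using sr unfolding sr_machine_def wf_fsm_def by blast
  show "p \<le> n" if "p \<in> set (states F)" for p using le(2) that .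
  show "\<exists>s. length s \<le> n \<and> run (msg_trans F) p s q"
    if "p \<in> set (states F)" "q \<in> set (states F)" for p q
  proof -
    have "(p, q) \<in> (edges F)\<^sup>*" using sr that unfolding sr_machine_def by blast
    then obtain k where "k \<le> card (edges F)" "(p, q) \<in> edges F ^^ k"
      unfolding rtrancl_finite_eq_relpow[OF finite_edges(1)] by blast
    then show ?thesis using relpow_edges_run finite_edges(2)[of F] le(3) le_trans by metis
  qed
qed

lemma sr_trans_label:
  "sr_machine Sig F \<Longrightarrow> (p, e, q) \<in> set (trans F) \<Longrightarrow> e \<in> Sig"
  unfolding sr_machine_def wf_fsm_def by fastforce

lemma sr_trans_state:
  assumes "sr_machine Sig F" "(p, e, q) \<in> set (trans F)"
  shows "send_state F p \<or> receive_state F p"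
proof -
  have "p \<in> set (states F)" using assms unfolding sr_machine_def wf_fsm_def by fastforce
  then show ?thesis using assms(1) unfolding sr_machine_def by blast
qed

lemma Sigma0_iff:
  assumes "sr_pair P" "e \<in> Sigma0 P"
  shows "is_send e \<longleftrightarrow> msg e \<in> set (M_alpha P)" "msg e \<in> set (M_beta P) \<longleftrightarrow> msg e \<notin> set (M_alpha P)"
  using assms unfolding sr_pair_def Sigma0_def by auto

lemma Sigma1_iff:
  assumes "sr_pair P" "e \<in> Sigma1 P"
  shows "is_send e \<longleftrightarrow> msg e \<notin> set (M_alpha P)" "msg e \<in> set (M_beta P) \<longleftrightarrow> msg e \<notin> set (M_alpha P)"
  using assms unfolding sr_pair_def Sigma1_def by auto

lemma act_eqI: "is_send e = is_send e' \<Longrightarrow> msg e = msg e' \<Longrightarrow> e = e'"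
  by (cases e; cases e') auto

lemma sr_pair_machine_pair:
  assumes P: "sr_pair P" and cyc: "\<not> has_send_cycle (F0 P)" "\<not> has_send_cycle (F1 P)"
    and le: "\<And>m. m \<in> set (M_alpha P) \<union> set (M_beta P) \<Longrightarrow> m \<le> n"
      "\<And>p. p \<in> set (states (F0 P)) \<union> set (states (F1 P)) \<Longrightarrow> p \<le> n"
      "length (trans (F0 P)) \<le> n" "length (trans (F1 P)) \<le> n"
  shows "machine_pair (set (M_alpha P)) (msg_trans (F0 P)) (initial (F0 P)) (set (states (F0 P)))
    (msg_trans (F1 P)) (initial (F1 P)) (set (states (F1 P))) n"
proof (intro machine_pair.intro machine_pair_axioms.intro)
  have sr: "sr_machine (Sigma0 P) (F0 P)" "sr_machine (Sigma1 P) (F1 P)"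
    using P unfolding sr_pair_def by auto
  show "machine (set (M_alpha P)) (msg_trans (F0 P)) (initial (F0 P)) (set (states (F0 P))) n"
  proof (rule sr_machine_imp_machine[OF sr(1)])
    show "inj_on msg (Sigma0 P)"
      by (rule inj_onI, rule act_eqI) (simp_all add: Sigma0_iff(1)[OF P])
    show "msg e \<le> n" if "e \<in> Sigma0 P" for e
      using that le(1) unfolding Sigma0_def by auto
  qed (use Sigma0_iff[OF P] le in auto)
  show "machine (set (M_alpha P)) (msg_trans (F1 P)) (initial (F1 P)) (set (states (F1 P))) n"
  proof (rule sr_machine_imp_machine[OF sr(2)])
    show "inj_on msg (Sigma1 P)"
      by (rule inj_onI, rule act_eqI) (simp_all add: Sigma1_iff(1)[OF P])
    show "msg e \<le> n" if "e \<in> Sigma1 P" for e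
      using that le(1) unfolding Sigma1_def by auto
  qed (use Sigma1_iff[OF P] le in auto)
  show "length u \<le> n" if "run (msg_trans (F0 P)) p u q" "\<forall>m\<in>set u. m \<in> set (M_alpha P)" for p u q
    by (rule run_sends_length_le[OF cyc(1) le(3) that(1)])
      (use that(2) Sigma0_iff(1)[OF P] sr_trans_label[OF sr(1)] in blast)
  show "length u \<le> n" if "run (msg_trans (F1 P)) p u q" "\<forall>m\<in>set u. m \<notin> set (M_alpha P)" for p u q
    by (rule run_sends_length_le[OF cyc(2) le(4) that(1)])
      (use that(2) Sigma1_iff(1)[OF P] sr_trans_label[OF sr(2)] in blast)
qed

text \<open>By the hypothesis on labels, membership in \<open>M_beta\<close> may be replaced along
  runs by non-membership in \<open>M_alpha\<close>, which is the form used in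
  \<open>same_proj\<close>.\<close>

lemma Zset_eq_runs:
  assumes "\<And>p e q. (p, e, q) \<in> set (trans F) \<Longrightarrow> msg e \<in> set (M_beta P) \<longleftrightarrow> msg e \<notin> set (M_alpha P)"
  shows "Zset P F = (\<lambda>u. (filter (\<lambda>m. m \<in> set (M_alpha P)) u, filter (\<lambda>m. m \<notin> set (M_alpha P)) u)) `
      {u. run (msg_trans F) (initial F) u (initial F)}"
proof -
  have proj: "proj M w = filter (\<lambda>m. m \<in> set M) (map msg w)" for M w
    unfolding proj_def by (induction w) auto
  have beta: "filter (\<lambda>m. m \<in> set (M_beta P)) u = filter (\<lambda>m. m \<notin> set (M_alpha P)) u"
    if "run (msg_trans F) p u q" for p u q
    using that
  proof (induction u arbitrary: p)
    case (Cons m u)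
    then obtain r where "(p, m, r) \<in> msg_trans F" "run (msg_trans F) r u q" by auto
    then show ?case using Cons.IH assms by (auto simp: msg_trans_iff)
  qed simp
  show ?thesis
  proof (intro set_eqI iffI)
    fix z assume "z \<in> Zset P F"
    then obtain w where "z = (proj (M_alpha P) w, proj (M_beta P) w)" "path F (initial F) w (initial F)"
      unfolding Zset_def by blast
    then show "z \<in> (\<lambda>u. (filter (\<lambda>m. m \<in> set (M_alpha P)) u, filter (\<lambda>m. m \<notin> set (M_alpha P)) u)) `
      {u. run (msg_trans F) (initial F) u (initial F)}"
      using path_run beta unfolding proj by fastforce
  next
    fix z assume "z \<in> (\<lambda>u. (filter (\<lambda>m. m \<in> set (M_alpha P)) u, filter (\<lambda>m. m \<notin> set (M_alpha P)) u)) `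
      {u. run (msg_trans F) (initial F) u (initial F)}"
    then obtain u where u: "z = (filter (\<lambda>m. m \<in> set (M_alpha P)) u, filter (\<lambda>m. m \<notin> set (M_alpha P)) u)"
      "run (msg_trans F) (initial F) u (initial F)" by blast
    from run_path[OF u(2)] obtain w where w: "path F (initial F) w (initial F)" "map msg w = u" by blast
    have "z = (proj (M_alpha P) w, proj (M_beta P) w)"
      using u(1) beta[OF u(2)] w(2) unfolding proj by simp
    then show "z \<in> Zset P F" using w(1) unfolding Zset_def by blast
  qed
qed

lemma image_eq_image_iff:
  "g ` X = g ` Y \<longleftrightarrow> (\<forall>x\<in>X. \<exists>y\<in>Y. g x = g y) \<and> (\<forall>y\<in>Y. \<exists>x\<in>X. g x = g y)"
  unfolding set_eq_subset image_subset_iff image_iff by metis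

lemma affine_iff_runs:
  assumes P: "sr_pair P"
  shows "affine P \<longleftrightarrow>
    (\<forall>u. run (msg_trans (F0 P)) (initial (F0 P)) u (initial (F0 P)) \<longrightarrow>
      (\<exists>v. same_proj (set (M_alpha P)) u v \<and> run (msg_trans (F1 P)) (initial (F1 P)) v (initial (F1 P)))) \<and>
    (\<forall>v. run (msg_trans (F1 P)) (initial (F1 P)) v (initial (F1 P)) \<longrightarrow>
      (\<exists>u. same_proj (set (M_alpha P)) u v \<and> run (msg_trans (F0 P)) (initial (F0 P)) u (initial (F0 P))))"
proof -
  have sr: "sr_machine (Sigma0 P) (F0 P)" "sr_machine (Sigma1 P) (F1 P)"
    using P unfolding sr_pair_def by auto
  have Z0: "Zset P (F0 P) = (\<lambda>u. (filter (\<lambda>m. m \<in> set (M_alpha P)) u, filter (\<lambda>m. m \<notin> set (M_alpha P)) u)) `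
      {u. run (msg_trans (F0 P)) (initial (F0 P)) u (initial (F0 P))}"
    by (rule Zset_eq_runs) (use Sigma0_iff(2)[OF P] sr_trans_label[OF sr(1)] in blast)
  have Z1: "Zset P (F1 P) = (\<lambda>u. (filter (\<lambda>m. m \<in> set (M_alpha P)) u, filter (\<lambda>m. m \<notin> set (M_alpha P)) u)) `
      {u. run (msg_trans (F1 P)) (initial (F1 P)) u (initial (F1 P))}"
    by (rule Zset_eq_runs) (use Sigma1_iff(2)[OF P] sr_trans_label[OF sr(2)] in blast)
  show ?thesis
    unfolding affine_def same_proj_def Z0 Z1 image_eq_image_iff by auto
qed

section \<open>Global executions as pairs of runs\<close>

lemma run_snoc: "run T p u q \<Longrightarrow> (q, m, r) \<in> T \<Longrightarrow> run T p (u @ [m]) r"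
  by (auto simp: run_append)

text \<open>The invariant says that a channel holds what was sent and not yet received. For empty
  channels it turns into \<open>same_proj\<close>.\<close>

lemma reachable_runs:
  assumes P: "sr_pair P" and "reachable P s"
  shows "case s of ((p, q), (xa, xb)) \<Rightarrow> \<exists>u v.
    run (msg_trans (F0 P)) (initial (F0 P)) u p \<and> run (msg_trans (F1 P)) (initial (F1 P)) v q \<and>
    filter (\<lambda>m. m \<in> set (M_alpha P)) u = filter (\<lambda>m. m \<in> set (M_alpha P)) v @ xa \<and>
    filter (\<lambda>m. m \<notin> set (M_alpha P)) v = filter (\<lambda>m. m \<notin> set (M_alpha P)) u @ xb"
  using assms(2) unfolding reachable_def
proof (induction rule: rtranclp_induct)
  case base
  show ?case unfolding init_gstate_def by (auto intro!: exI[of _ "[]"])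
next
  case (step s s')
  have sr: "sr_machine (Sigma0 P) (F0 P)" "sr_machine (Sigma1 P) (F1 P)"
    using P unfolding sr_pair_def by auto
  have lab: "(p, Snd b, q) \<in> set (trans (F0 P)) \<Longrightarrow> b \<in> set (M_alpha P)"
     "(p, Rcv b, q) \<in> set (trans (F0 P)) \<Longrightarrow> b \<notin> set (M_alpha P)"
     "(p, Snd b, q) \<in> set (trans (F1 P)) \<Longrightarrow> b \<notin> set (M_alpha P)"
     "(p, Rcv b, q) \<in> set (trans (F1 P)) \<Longrightarrow> b \<in> set (M_alpha P)" for p b q
    using Sigma0_iff(1)[OF P] Sigma1_iff(1)[OF P] sr_trans_label[OF sr(1)] sr_trans_label[OF sr(2)]
    by (metis is_send.simps msg.simps)+
  from step(2) show ?case
  proof cases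
    case (send0 p0 b q p1 xa xb)
    then obtain u v where uv: "run (msg_trans (F0 P)) (initial (F0 P)) u p0"
      "run (msg_trans (F1 P)) (initial (F1 P)) v p1"
      "filter (\<lambda>m. m \<in> set (M_alpha P)) u = filter (\<lambda>m. m \<in> set (M_alpha P)) v @ xa"
      "filter (\<lambda>m. m \<notin> set (M_alpha P)) v = filter (\<lambda>m. m \<notin> set (M_alpha P)) u @ xb"
      using step.IH by auto
    have "run (msg_trans (F0 P)) (initial (F0 P)) (u @ [b]) q"
      using run_snoc[OF uv(1)] send0(3) by (force simp: msg_trans_iff)
    then show ?thesis
      unfolding send0(2) prod.case
      by (intro exI[of _ "u @ [b]"] exI[of _ "v"]) (use uv lab(1)[OF send0(3)] in simp)
  next
    case (recv0 p0 b q p1 xa xb)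
    then obtain u v where uv: "run (msg_trans (F0 P)) (initial (F0 P)) u p0"
      "run (msg_trans (F1 P)) (initial (F1 P)) v p1"
      "filter (\<lambda>m. m \<in> set (M_alpha P)) u = filter (\<lambda>m. m \<in> set (M_alpha P)) v @ xa"
      "filter (\<lambda>m. m \<notin> set (M_alpha P)) v = filter (\<lambda>m. m \<notin> set (M_alpha P)) u @ b # xb"
      using step.IH by auto
    have "run (msg_trans (F0 P)) (initial (F0 P)) (u @ [b]) q"
      using run_snoc[OF uv(1)] recv0(3) by (force simp: msg_trans_iff)
    then show ?thesis
      unfolding recv0(2) prod.case
      by (intro exI[of _ "u @ [b]"] exI[of _ "v"]) (use uv lab(2)[OF recv0(3)] in simp)
  next
    case (send1 p1 b q p0 xa xb)
    then obtain u v where uv: "run (msg_trans (F0 P)) (initial (F0 P)) u p0"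
      "run (msg_trans (F1 P)) (initial (F1 P)) v p1"
      "filter (\<lambda>m. m \<in> set (M_alpha P)) u = filter (\<lambda>m. m \<in> set (M_alpha P)) v @ xa"
      "filter (\<lambda>m. m \<notin> set (M_alpha P)) v = filter (\<lambda>m. m \<notin> set (M_alpha P)) u @ xb"
      using step.IH by auto
    have "run (msg_trans (F1 P)) (initial (F1 P)) (v @ [b]) q"
      using run_snoc[OF uv(2)] send1(3) by (force simp: msg_trans_iff)
    then show ?thesis
      unfolding send1(2) prod.case
      by (intro exI[of _ "u"] exI[of _ "v @ [b]"]) (use uv lab(3)[OF send1(3)] in simp)
  next
    case (recv1 p1 b q p0 xa xb)
    then obtain u v where uv: "run (msg_trans (F0 P)) (initial (F0 P)) u p0"
      "run (msg_trans (F1 P)) (initial (F1 P)) v p1"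
      "filter (\<lambda>m. m \<in> set (M_alpha P)) u = filter (\<lambda>m. m \<in> set (M_alpha P)) v @ b # xa"
      "filter (\<lambda>m. m \<notin> set (M_alpha P)) v = filter (\<lambda>m. m \<notin> set (M_alpha P)) u @ xb"
      using step.IH by auto
    have "run (msg_trans (F1 P)) (initial (F1 P)) (v @ [b]) q"
      using run_snoc[OF uv(2)] recv1(3) by (force simp: msg_trans_iff)
    then show ?thesis
      unfolding recv1(2) prod.case
      by (intro exI[of _ "u"] exI[of _ "v @ [b]"]) (use uv lab(4)[OF recv1(3)] in simp)
  qed
qed

text \<open>Two runs with the same projections can be executed concurrently until both are finished or
  both machines wait on empty channels.\<close>
lemma runs_reach_deadlock:
  assumes P: "sr_pair P"
  shows "reachable P ((p, q), (xa, xb)) \<Longrightarrow> run (msg_trans (F0 P)) p u p' \<Longrightarrow> run (msg_trans (F1 P)) q v q' \<Longrightarrow>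
    xa @ filter (\<lambda>m. m \<in> set (M_alpha P)) u = filter (\<lambda>m. m \<in> set (M_alpha P)) v \<Longrightarrow>
    xb @ filter (\<lambda>m. m \<notin> set (M_alpha P)) v = filter (\<lambda>m. m \<notin> set (M_alpha P)) u \<Longrightarrow>
    receive_state (F0 P) p' \<Longrightarrow> receive_state (F1 P) q' \<Longrightarrow> \<exists>s. reachable P s \<and> deadlocked P s"
proof (induction "length u + length v" arbitrary: p q xa xb u v rule: less_induct)
  case less
  have sr: "sr_machine (Sigma0 P) (F0 P)" "sr_machine (Sigma1 P) (F1 P)"
    using P unfolding sr_pair_def by auto
  have reach: "reachable P s'" if "gstep P ((p, q), (xa, xb)) s'" for s'
    using less.prems(1) that unfolding reachable_def by simp
  have lab0: "if m \<in> set (M_alpha P) then (p, Snd m, r) \<in> set (trans (F0 P))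
     else (p, Rcv m, r) \<in> set (trans (F0 P))" if "(p, m, r) \<in> msg_trans (F0 P)" for m r
    using that Sigma0_iff(1)[OF P] sr_trans_label[OF sr(1)] unfolding msg_trans_iff
    by (metis is_send.elims msg.simps)
  have lab1: "if m \<notin> set (M_alpha P) then (q, Snd m, r) \<in> set (trans (F1 P))
     else (q, Rcv m, r) \<in> set (trans (F1 P))" if "(q, m, r) \<in> msg_trans (F1 P)" for m r
    using that Sigma1_iff(1)[OF P] sr_trans_label[OF sr(2)] unfolding msg_trans_iff
    by (metis is_send.elims msg.simps)
  \<comment> \<open>Each of the first four cases is a possible move; in \<open>stuck\<close> every
    unfinished machine waits for a message on an empty channel.\<close>
  consider (send0) m u' where "u = m # u'" "m \<in> set (M_alpha P)"
    | (recv0) m u' b xb' where "u = m # u'" "m \<notin> set (M_alpha P)" "xb = b # xb'"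
    | (send1) m v' where "v = m # v'" "m \<notin> set (M_alpha P)"
    | (recv1) m v' b xa' where "v = m # v'" "m \<in> set (M_alpha P)" "xa = b # xa'"
    | (stuck) "u = [] \<or> hd u \<notin> set (M_alpha P) \<and> xb = []" "v = [] \<or> hd v \<in> set (M_alpha P) \<and> xa = []"
    by (metis list.exhaust list.sel(1))
  then show ?case
  proof cases
    case send0
    then obtain r where r: "(p, m, r) \<in> msg_trans (F0 P)" "run (msg_trans (F0 P)) r u' p'"
      using less.prems(2) by auto
    have "reachable P ((r, q), (xa @ [m], xb))"
      using lab0[OF r(1)] send0 by (auto intro!: reach gstep.send0)
    from less.hyps[OF _ this r(2) less.prems(3)] show ?thesis using less.prems send0 by simp
  next
    case recv0
    then obtain r where r: "(p, m, r) \<in> msg_trans (F0 P)" "run (msg_trans (F0 P)) r u' p'"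
      using less.prems(2) by auto
    have "b = m" using less.prems(5) recv0 by simp
    then have "reachable P ((r, q), (xa, xb'))"
      using lab0[OF r(1)] recv0 by (auto intro!: reach gstep.recv0)
    from less.hyps[OF _ this r(2) less.prems(3)] show ?thesis using less.prems recv0 by simp
  next
    case send1
    then obtain r where r: "(q, m, r) \<in> msg_trans (F1 P)" "run (msg_trans (F1 P)) r v' q'"
      using less.prems(3) by auto
    have "reachable P ((p, r), (xa, xb @ [m]))"
      using lab1[OF r(1)] send1 by (auto intro!: reach gstep.send1)
    from less.hyps[OF _ this less.prems(2) r(2)] show ?thesis using less.prems send1 by simp
  next
    case recv1
    then obtain r where r: "(q, m, r) \<in> msg_trans (F1 P)" "run (msg_trans (F1 P)) r v' q'"
      using less.prems(3) by auto
    have "b = m" using less.prems(4) recv1 by simp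
    then have "reachable P ((p, r), (xa', xb))"
      using lab1[OF r(1)] recv1 by (auto intro!: reach gstep.recv1)
    from less.hyps[OF _ this less.prems(2) r(2)] show ?thesis using less.prems recv1 by simp
  next
    case stuck
    \<comment> \<open>If only one run were finished, the other would begin with a receive from an
      empty channel, and no matching send would remain to balance the projections.\<close>
    have empty: "xa = [] \<and> xb = [] \<and> (u = [] \<longleftrightarrow> v = [])"
      using stuck less.prems(4,5) by (cases u; cases v) (auto split: if_splits)
    \<comment> \<open>An unfinished machine is about to receive, so its present state is a receive
      state. The deadlock may thus occur before the ends of the given runs.\<close>
    have "receive_state (F0 P) p"
    proof (cases u)
      case (Cons m u')
      then obtain r where "(p, m, r) \<in> msg_trans (F0 P)" using less.prems(2) by auto
      from lab0[OF this] have "(p, Rcv m, r) \<in> set (trans (F0 P))" using stuck(1) Cons by simp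
      with sr_trans_state[OF sr(1) this] show ?thesis unfolding send_state_def by blast
    qed (use less.prems in simp)
    moreover have "receive_state (F1 P) q"
    proof (cases v)
      case (Cons m v')
      then obtain r where "(q, m, r) \<in> msg_trans (F1 P)" using less.prems(3) by auto
      from lab1[OF this] have "(q, Rcv m, r) \<in> set (trans (F1 P))" using stuck(2) Cons by simp
      with sr_trans_state[OF sr(2) this] show ?thesis unfolding send_state_def by blast
    qed (use less.prems in simp)
    ultimately have "deadlocked P ((p, q), (xa, xb))" using empty unfolding deadlocked_def by simp
    then show ?thesis using less.prems(1) by blast
  qed
qed

lemma deadlock_free_iff_runs:
  assumes P: "sr_pair P"
  shows "deadlock_free P \<longleftrightarrow> (\<forall>u v p q.
    run (msg_trans (F0 P)) (initial (F0 P)) u p \<longrightarrow> run (msg_trans (F1 P)) (initial (F1 P)) v q \<longrightarrow>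
    same_proj (set (M_alpha P)) u v \<longrightarrow> \<not> (receive_state (F0 P) p \<and> receive_state (F1 P) q))"
proof (intro iffI allI impI notI)
  fix u v p q
  assume "deadlock_free P" "run (msg_trans (F0 P)) (initial (F0 P)) u p"
    "run (msg_trans (F1 P)) (initial (F1 P)) v q" "same_proj (set (M_alpha P)) u v"
    "receive_state (F0 P) p \<and> receive_state (F1 P) q"
  moreover have "reachable P ((initial (F0 P), initial (F1 P)), ([], []))"
    unfolding reachable_def init_gstate_def by simp
  ultimately show False
    using runs_reach_deadlock[OF P, of "initial (F0 P)" "initial (F1 P)" "[]" "[]" u p v q]
    unfolding same_proj_def deadlock_free_def by auto
next
  assume runs: "\<forall>u v p q.
    run (msg_trans (F0 P)) (initial (F0 P)) u p \<longrightarrow> run (msg_trans (F1 P)) (initial (F1 P)) v q \<longrightarrow>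
    same_proj (set (M_alpha P)) u v \<longrightarrow> \<not> (receive_state (F0 P) p \<and> receive_state (F1 P) q)"
  show "deadlock_free P"
    unfolding deadlock_free_def
  proof (intro allI impI notI)
    fix s assume s: "reachable P s" "deadlocked P s"
    then obtain p q where "s = ((p, q), ([], []))" "receive_state (F0 P) p" "receive_state (F1 P) q"
      unfolding deadlocked_def by (auto split: prod.splits)
    with reachable_runs[OF P s(1)] runs show False
      unfolding same_proj_def by fastforce
  qed
qed

section \<open>The bounded search\<close>

text \<open>Access to a component of a coded list: \<open>i\<close> tails, then a head, each
  \<open>- 1\<close> removing the \<open>Suc\<close> of a nonempty list's code.\<close>

definition entry :: "nat \<Rightarrow> nat \<Rightarrow> nat" where
  "entry i c = fst (prod_decode (rec_nat c (\<lambda>_ a. snd (prod_decode (a - 1))) i - 1))"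

lemma entry_list_encode: "i < length xs \<Longrightarrow> entry i (list_encode xs) = xs ! i"
proof -
  assume i: "i < length xs"
  have "rec_nat (list_encode xs) (\<lambda>_ a. snd (prod_decode (a - 1))) i = list_encode (drop i xs)"
    if "i \<le> length xs" for i
    using that
  proof (induction i)
    case (Suc i)
    then show ?case by (simp add: Cons_nth_drop_Suc[symmetric])
  qed simp
  with i show ?thesis by (simp add: entry_def Cons_nth_drop_Suc[symmetric])
qed

definition tsrc :: "nat \<Rightarrow> nat" where "tsrc t = fst (prod_decode t)"
definition tact :: "nat \<Rightarrow> nat" where "tact t = fst (prod_decode (snd (prod_decode t)))"
definition ttgt :: "nat \<Rightarrow> nat" where "ttgt t = snd (prod_decode (snd (prod_decode t)))"
text \<open>Sends have even and receives odd codes, so halving removes the sign.\<close>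

definition tmsg :: "nat \<Rightarrow> nat" where "tmsg t = tact t div 2"

lemma enc_trans_sel:
  "tsrc (enc_trans (p, e, q)) = p" "tact (enc_trans (p, e, q)) = enc_act e"
  "ttgt (enc_trans (p, e, q)) = q" "tmsg (enc_trans (p, e, q)) = msg e"
  by (cases e; simp add: tsrc_def tact_def ttgt_def tmsg_def enc_trans_def)+

text \<open>The end state plus one of the path with transition codes \<open>ts\<close>, or \<open>0\<close> if \<open>ts\<close> is not a path.\<close>
definition walk :: "nat set \<Rightarrow> nat \<Rightarrow> nat list \<Rightarrow> nat" where
  "walk T p ts = foldl (\<lambda>a t. if t \<in> T \<and> a = Suc (tsrc t) then Suc (ttgt t) else 0) (Suc p) ts"

lemma walk_simps:
  "walk T p [] = Suc p"
  "walk T p (t # ts) = (if t \<in> T \<and> p = tsrc t then walk T (ttgt t) ts else 0)"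
proof -
  have "foldl (\<lambda>a t. if t \<in> T \<and> a = Suc (tsrc t) then Suc (ttgt t) else 0) 0 ts = 0"
    by (induction ts) auto
  then show "walk T p (t # ts) = (if t \<in> T \<and> p = tsrc t then walk T (ttgt t) ts else 0)"
    by (simp add: walk_def)
qed (simp add: walk_def)

lemma walk_run:
  "walk (enc_trans ` set (trans F)) p ts = Suc q \<Longrightarrow> run (msg_trans F) p (map tmsg ts) q"
proof (induction ts arbitrary: p)
  case (Cons t ts)
  then obtain x e y where t: "t = enc_trans (x, e, y)" "(x, e, y) \<in> set (trans F)"
    and "p = tsrc t" "walk (enc_trans ` set (trans F)) (ttgt t) ts = Suc q"
    by (auto simp: walk_simps split: if_splits)
  then show ?case using Cons.IH[of y] by (auto simp: enc_trans_sel msg_trans_iff)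
qed (simp add: walk_simps)

lemma run_walk:
  "run (msg_trans F) p u q \<Longrightarrow> \<exists>ts. map tmsg ts = u \<and> set ts \<subseteq> enc_trans ` set (trans F)
     \<and> walk (enc_trans ` set (trans F)) p ts = Suc q"
proof (induction u arbitrary: p)
  case (Cons m u)
  then obtain e r where e: "(p, e, r) \<in> set (trans F)" "msg e = m" "run (msg_trans F) r u q"
    by (auto simp: msg_trans_iff)
  from Cons.IH[OF e(3)] obtain ts where "map tmsg ts = u" "set ts \<subseteq> enc_trans ` set (trans F)"
    "walk (enc_trans ` set (trans F)) r ts = Suc q" by blast
  then show ?case
    using e by (intro exI[of _ "enc_trans (p, e, r) # ts"]) (auto simp: enc_trans_sel walk_simps)
qed (simp add: walk_simps)

text \<open>Folding from the left produces the code of the reversed projection; this suffices,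
  because these codes are only compared for equality.\<close>

definition proj_code :: "(nat \<Rightarrow> bool) \<Rightarrow> nat list \<Rightarrow> nat" where
  "proj_code Q ts = foldl (\<lambda>a t. if Q (tmsg t) then Suc (prod_encode (tmsg t, a)) else a) 0 ts"

lemma proj_code_eq: "proj_code Q ts = list_encode (rev (filter Q (map tmsg ts)))"
proof -
  have "foldl (\<lambda>a t. if Q (tmsg t) then Suc (prod_encode (tmsg t, a)) else a) (list_encode xs) ts
    = list_encode (rev (filter Q (map tmsg ts)) @ xs)" for xs
  proof (induction ts arbitrary: xs)
    case (Cons t ts)
    show ?case using Cons[of xs] Cons[of "tmsg t # xs"] by simp
  qed simp
  from this[of "[]"] show ?thesis by (simp add: proj_code_def)
qed

definition same_code :: "nat set \<Rightarrow> nat list \<Rightarrow> nat list \<Rightarrow> bool" where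
  "same_code A ts us \<longleftrightarrow> proj_code (\<lambda>m. m \<in> A) ts = proj_code (\<lambda>m. m \<in> A) us
     \<and> proj_code (\<lambda>m. m \<notin> A) ts = proj_code (\<lambda>m. m \<notin> A) us"

lemma same_code_iff: "same_code A ts us \<longleftrightarrow> same_proj A (map tmsg ts) (map tmsg us)"
  unfolding same_code_def same_proj_def proj_code_eq by (simp add: list_encode_eq)

definition receive_code :: "nat set \<Rightarrow> nat \<Rightarrow> bool" where
  "receive_code T p \<longleftrightarrow> (\<forall>t\<in>T. \<not> (tsrc t = p \<and> even (tact t)))"

lemma receive_code_iff: "receive_code (enc_trans ` set (trans F)) p \<longleftrightarrow> receive_state F p"
proof -
  have "even (enc_act e) \<longleftrightarrow> is_send e" for e by (cases e) auto
  moreover have "is_send e \<longleftrightarrow> (\<exists>b. e = Snd b)" for e by (cases e) auto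
  ultimately show ?thesis
    unfolding receive_code_def receive_state_def by (auto simp: enc_trans_sel)
qed

text \<open>Both \<open>c\<close> and \<open>d\<close> code lists of transition codes. The guard on
  the length of \<open>c\<close> matters: for a longer list with a small code, a search below
  \<open>B\<close> could miss an existing partner. Equal projections force equal lengths, so
  \<open>d\<close> inherits the guard.\<close>

definition bounded_check :: "nat \<Rightarrow> nat \<Rightarrow> nat set \<Rightarrow> nat set \<Rightarrow> nat \<Rightarrow> nat set \<Rightarrow> nat \<Rightarrow> bool" where
  "bounded_check N B A T0 h0 T1 h1 \<longleftrightarrow>
    (\<forall>c<B. length (list_decode c) \<le> N \<longrightarrow>
      (walk T0 h0 (list_decode c) = Suc h0 \<longrightarrow>
        (\<exists>d<B. same_code A (list_decode c) (list_decode d) \<and> walk T1 h1 (list_decode d) = Suc h1)) \<and>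
      (walk T1 h1 (list_decode c) = Suc h1 \<longrightarrow>
        (\<exists>d<B. same_code A (list_decode c) (list_decode d) \<and> walk T0 h0 (list_decode d) = Suc h0)) \<and>
      (\<forall>d<B. same_code A (list_decode c) (list_decode d) \<and>
        \<not> walk T0 h0 (list_decode c) = 0 \<and> \<not> walk T1 h1 (list_decode d) = 0 \<longrightarrow>
        \<not> (receive_code T0 (walk T0 h0 (list_decode c) - 1) \<and>
           receive_code T1 (walk T1 h1 (list_decode d) - 1))))"

text \<open>The input doubles as the size parameter: the code of a protocol is at least every state,
  message and transition code and the number of transitions of each machine.\<close>

definition check :: "nat \<Rightarrow> bool" where
  "check n \<longleftrightarrow> bounded_check (witness_bound n) (Suc (list_bound n (witness_bound n)))
    (set (list_decode (entry 0 n)))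
    (set (list_decode (entry 1 (entry 2 n)))) (entry 2 (entry 2 n))
    (set (list_decode (entry 1 (entry 3 n)))) (entry 2 (entry 3 n))"

section \<open>Computability of the search\<close>

lemma computable_mult:
  assumes "computable f" "computable g" shows "computable (\<lambda>x. f x * g x)"
proof -
  have eq: "a * b = rec_nat 0 (\<lambda>k s. s + a) b" for a b :: nat by (induction b) auto
  show ?thesis unfolding eq by (intro computable_intros computable_comp[OF assms(1)] assms)
qed

lemma computable_div2:
  assumes "computable f" shows "computable (\<lambda>x. f x div 2)"
proof -
  have eq: "a div 2 = rec_nat 0 (\<lambda>k s. if Suc (Suc (s + s)) \<le> Suc k then Suc s else s) a" for a :: nat
  proof (induction a)
    case (Suc a)
    have "Suc a div 2 = (if Suc (Suc (a div 2 + a div 2)) \<le> Suc a then Suc (a div 2) else a div 2)"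
      by presburger
    with Suc show ?case by simp
  qed simp
  show ?thesis unfolding eq by (intro computable_intros assms)
qed

lemma decidable_even:
  assumes "computable f" shows "decidable (\<lambda>x. even (f x))"
proof -
  have eq: "even a \<longleftrightarrow> a div 2 + a div 2 = a" for a :: nat by presburger
  show ?thesis unfolding eq by (intro computable_intros computable_div2 assms)
qed

lemma computable_trans_sel:
  assumes "computable f"
  shows "computable (\<lambda>x. tsrc (f x))" "computable (\<lambda>x. tact (f x))" "computable (\<lambda>x. ttgt (f x))"
    "computable (\<lambda>x. tmsg (f x))"
  unfolding tsrc_def tact_def ttgt_def tmsg_def
  by (intro computable_intros computable_div2 assms)+

lemma computable_walk:
  assumes "computable t" "computable p" "computable c"
  shows "computable (\<lambda>x. walk (set (list_decode (t x))) (p x) (list_decode (c x)))"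
  unfolding walk_def
  by (intro computable_intros computable_trans_sel decidable_mem computable_comp[OF assms(1)] assms)

lemma decidable_same_code:
  assumes "computable a" "computable c" "computable d"
  shows "decidable (\<lambda>x. same_code (set (list_decode (a x))) (list_decode (c x)) (list_decode (d x)))"
  unfolding same_code_def proj_code_def
  by (intro computable_intros computable_trans_sel decidable_mem computable_comp[OF assms(1)] assms)

lemma decidable_receive_code:
  assumes "computable t" "computable p"
  shows "decidable (\<lambda>x. receive_code (set (list_decode (t x))) (p x))"
  unfolding receive_code_def
  by (intro computable_intros computable_trans_sel decidable_all_mem decidable_even
      computable_comp[OF assms(2)] assms)

lemma computable_entry: "computable f \<Longrightarrow> computable (\<lambda>x. entry i (f x))"
  unfolding entry_def by (intro computable_intros)

lemma computable_list_bound: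
  assumes "computable f" "computable g" shows "computable (\<lambda>x. list_bound (f x) (g x))"
  unfolding list_bound_def by (intro computable_intros computable_comp[OF assms(1)] assms)

lemma computable_witness_bound: "computable f \<Longrightarrow> computable (\<lambda>x. witness_bound (f x))"
  unfolding witness_bound_def config_bound_def lag_bound_def block_bound_def
  by (intro computable_intros computable_mult computable_list_bound)

lemma decidable_check: "decidable check"
  unfolding check_def bounded_check_def
  by (intro computable_intros computable_length computable_walk decidable_same_code
      decidable_receive_code computable_entry computable_list_bound computable_witness_bound)


section \<open>Correctness of the search\<close>

lemma le_list_encode: "x \<in> set xs \<Longrightarrow> x \<le> list_encode xs"
proof (induction xs)
  case (Cons y xs)
  then show ?case
    using le_prod_encode_1[of y "list_encode xs"] le_prod_encode_2[of "list_encode xs" y] by fastforce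
qed simp

lemma enc_proto_bounds:
  fixes P defines "n \<equiv> enc_proto P"
  assumes "F = F0 P \<or> F = F1 P"
  shows "p \<in> set (states F) \<Longrightarrow> p \<le> n" "t \<in> enc_trans ` set (trans F) \<Longrightarrow> t \<le> n"
    "length (trans F) \<le> n"
proof -
  have F: "enc_fsm F \<le> n"
    unfolding n_def enc_proto_def by (rule le_list_encode) (use assms(2) in auto)
  have "list_encode (states F) \<le> enc_fsm F" "list_encode (map enc_trans (trans F)) \<le> enc_fsm F"
    unfolding enc_fsm_def by (rule le_list_encode; simp)+
  then have le: "list_encode (states F) \<le> n" "list_encode (map enc_trans (trans F)) \<le> n" using F by auto
  show "p \<in> set (states F) \<Longrightarrow> p \<le> n" using le(1) le_list_encode le_trans by blast
  show "t \<in> enc_trans ` set (trans F) \<Longrightarrow> t \<le> n"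
    using le(2) le_list_encode[of t "map enc_trans (trans F)"] by simp
  show "length (trans F) \<le> n"
    using le(2) length_le_list_encode[of "map enc_trans (trans F)"] by simp
qed

lemma enc_proto_msg_le: "m \<in> set (M_alpha P) \<union> set (M_beta P) \<Longrightarrow> m \<le> enc_proto P"
proof -
  assume "m \<in> set (M_alpha P) \<union> set (M_beta P)"
  then obtain M where M: "M \<in> {M_alpha P, M_beta P}" "m \<in> set M" by blast
  then have "m \<le> list_encode M" by (simp add: le_list_encode)
  also have "\<dots> \<le> enc_proto P" unfolding enc_proto_def by (rule le_list_encode) (use M(1) in auto)
  finally show ?thesis .
qed

lemma entries:
  "entry 0 (enc_proto P) = list_encode (M_alpha P)"
  "entry 1 (entry 2 (enc_proto P)) = list_encode (map enc_trans (trans (F0 P)))"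
  "entry 2 (entry 2 (enc_proto P)) = initial (F0 P)"
  "entry 1 (entry 3 (enc_proto P)) = list_encode (map enc_trans (trans (F1 P)))"
  "entry 2 (entry 3 (enc_proto P)) = initial (F1 P)"
  unfolding enc_proto_def enc_fsm_def by (simp_all add: entry_list_encode del: list_encode.simps)

text \<open>Transition codes are at most \<open>enc_proto P\<close>, so \<open>list_bound\<close>
  covers every path of length at most \<open>N\<close> in either machine. A partner has the same
  length and hence lies below the same bound.\<close>

lemma check_iff_short_runs:
  fixes P defines "N \<equiv> witness_bound (enc_proto P)"
    and "R0 \<equiv> run (msg_trans (F0 P)) (initial (F0 P))" and "R1 \<equiv> run (msg_trans (F1 P)) (initial (F1 P))"
  shows "check (enc_proto P) \<longleftrightarrow>
    (\<forall>u. length u \<le> N \<longrightarrow>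
      (R0 u (initial (F0 P)) \<longrightarrow> (\<exists>v. same_proj (set (M_alpha P)) u v \<and> R1 v (initial (F1 P)))) \<and>
      (R1 u (initial (F1 P)) \<longrightarrow> (\<exists>v. same_proj (set (M_alpha P)) u v \<and> R0 v (initial (F0 P)))) \<and>
      (\<forall>v p q. same_proj (set (M_alpha P)) u v \<longrightarrow> R0 u p \<longrightarrow> R1 v q \<longrightarrow>
        \<not> (receive_state (F0 P) p \<and> receive_state (F1 P) q)))"
    (is "_ \<longleftrightarrow> ?short")
proof -
  define n A B where "n = enc_proto P" and "A = set (M_alpha P)" and "B = Suc (list_bound n N)"
  define T0 T1 where "T0 = enc_trans ` set (trans (F0 P))" and "T1 = enc_trans ` set (trans (F1 P))"
  define h0 h1 where "h0 = initial (F0 P)" and "h1 = initial (F1 P)"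
  have check: "check n \<longleftrightarrow> bounded_check N B A T0 h0 T1 h1"
    unfolding check_def n_def entries B_def A_def N_def T0_def T1_def h0_def h1_def by simp
  have short_code: "list_encode ts < B" if "length ts \<le> N" "set ts \<subseteq> T0 \<or> set ts \<subseteq> T1" for ts
  proof -
    have "\<forall>t\<in>set ts. t \<le> n"
      using that(2) enc_proto_bounds(2)[of _ P] unfolding T0_def T1_def n_def by blast
    then show ?thesis using list_encode_le_list_bound[OF that(1)] by (simp add: B_def less_Suc_eq_le)
  qed
  have code0: "\<exists>d<B. map tmsg (list_decode d) = u \<and> walk T0 h0 (list_decode d) = Suc q"
    if r: "R0 u q" and l: "length u \<le> N" for u q
  proof -
    obtain ts where "map tmsg ts = u" "set ts \<subseteq> T0" "walk T0 h0 ts = Suc q"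
      using run_walk[OF r[unfolded R0_def]] unfolding T0_def h0_def by blast
    with l short_code[of ts] show ?thesis by (intro exI[of _ "list_encode ts"]) auto
  qed
  have code1: "\<exists>d<B. map tmsg (list_decode d) = u \<and> walk T1 h1 (list_decode d) = Suc q"
    if r: "R1 u q" and l: "length u \<le> N" for u q
  proof -
    obtain ts where "map tmsg ts = u" "set ts \<subseteq> T1" "walk T1 h1 ts = Suc q"
      using run_walk[OF r[unfolded R1_def]] unfolding T1_def h1_def by blast
    with l short_code[of ts] show ?thesis by (intro exI[of _ "list_encode ts"]) auto
  qed
  have run0: "R0 (map tmsg ts) q" if "walk T0 h0 ts = Suc q" for ts q
    using walk_run that unfolding R0_def T0_def h0_def by blast
  have run1: "R1 (map tmsg ts) q" if "walk T1 h1 ts = Suc q" for ts q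
    using walk_run that unfolding R1_def T1_def h1_def by blast
  have recv: "receive_code T0 p \<longleftrightarrow> receive_state (F0 P) p" "receive_code T1 p \<longleftrightarrow> receive_state (F1 P) p" for p
    unfolding T0_def T1_def by (rule receive_code_iff)+
  have "bounded_check N B A T0 h0 T1 h1 \<longleftrightarrow> ?short"
  proof
    assume bc: "bounded_check N B A T0 h0 T1 h1"
    show ?short
    proof (intro allI impI conjI)
      fix u assume u: "length u \<le> N" "R0 u (initial (F0 P))"
      from code0[OF u(2,1)] obtain c where c: "c < B" "map tmsg (list_decode c) = u"
        "walk T0 h0 (list_decode c) = Suc h0" unfolding h0_def by blast
      moreover have "length (list_decode c) \<le> N" using u(1) c(2) by auto
      ultimately obtain d where "same_code A (list_decode c) (list_decode d)" "walk T1 h1 (list_decode d) = Suc h1"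
        using bc unfolding bounded_check_def by blast
      then show "\<exists>v. same_proj (set (M_alpha P)) u v \<and> R1 v (initial (F1 P))"
        using run1 c(2) unfolding same_code_iff A_def h1_def by blast
    next
      fix u assume u: "length u \<le> N" "R1 u (initial (F1 P))"
      from code1[OF u(2,1)] obtain c where c: "c < B" "map tmsg (list_decode c) = u"
        "walk T1 h1 (list_decode c) = Suc h1" unfolding h1_def by blast
      moreover have "length (list_decode c) \<le> N" using u(1) c(2) by auto
      ultimately obtain d where "same_code A (list_decode c) (list_decode d)" "walk T0 h0 (list_decode d) = Suc h0"
        using bc unfolding bounded_check_def by blast
      then show "\<exists>v. same_proj (set (M_alpha P)) u v \<and> R0 v (initial (F0 P))"
        using run0 c(2) unfolding same_code_iff A_def h0_def by blast
    next
      fix u v p q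
      assume u: "length u \<le> N" and uv: "same_proj (set (M_alpha P)) u v" and r: "R0 u p" "R1 v q"
      from code0[OF r(1) u] obtain c where c: "c < B" "map tmsg (list_decode c) = u"
        "walk T0 h0 (list_decode c) = Suc p" by blast
      have "length v \<le> N" using same_proj_length[OF uv] u by simp
      from code1[OF r(2) this] obtain d where d: "d < B" "map tmsg (list_decode d) = v"
        "walk T1 h1 (list_decode d) = Suc q" by blast
      have "length (list_decode c) \<le> N" using u c(2) by auto
      moreover have "same_code A (list_decode c) (list_decode d)"
        using uv c(2) d(2) unfolding same_code_iff A_def by simp
      ultimately have "\<not> (receive_code T0 (walk T0 h0 (list_decode c) - 1) \<and>
           receive_code T1 (walk T1 h1 (list_decode d) - 1))"
        using bc c(1,3) d(1,3) unfolding bounded_check_def by (metis nat.distinct(1))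
      then show "\<not> (receive_state (F0 P) p \<and> receive_state (F1 P) q)"
        using c(3) d(3) recv by simp
    qed
  next
    assume short: ?short
    show "bounded_check N B A T0 h0 T1 h1"
      unfolding bounded_check_def
    proof (intro allI impI conjI)
      fix c assume c: "length (list_decode c) \<le> N" "walk T0 h0 (list_decode c) = Suc h0"
      then have "R0 (map tmsg (list_decode c)) (initial (F0 P))" using run0 unfolding h0_def by blast
      with short c(1) obtain v where v: "same_proj A (map tmsg (list_decode c)) v" "R1 v h1"
        unfolding A_def h1_def by (metis length_map)
      then have "length v \<le> N" using c(1) same_proj_length by fastforce
      from code1[OF v(2) this] v(1)
      show "\<exists>d<B. same_code A (list_decode c) (list_decode d) \<and> walk T1 h1 (list_decode d) = Suc h1"
        unfolding same_code_iff by blast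
    next
      fix c assume c: "length (list_decode c) \<le> N" "walk T1 h1 (list_decode c) = Suc h1"
      then have "R1 (map tmsg (list_decode c)) (initial (F1 P))" using run1 unfolding h1_def by blast
      with short c(1) obtain v where v: "same_proj A (map tmsg (list_decode c)) v" "R0 v h0"
        unfolding A_def h0_def by (metis length_map)
      then have "length v \<le> N" using c(1) same_proj_length by fastforce
      from code0[OF v(2) this] v(1)
      show "\<exists>d<B. same_code A (list_decode c) (list_decode d) \<and> walk T0 h0 (list_decode d) = Suc h0"
        unfolding same_code_iff by blast
    next
      fix c d
      assume c: "length (list_decode c) \<le> N" and cd: "same_code A (list_decode c) (list_decode d) \<and>
        \<not> walk T0 h0 (list_decode c) = 0 \<and> \<not> walk T1 h1 (list_decode d) = 0"
      then obtain p q where pq: "walk T0 h0 (list_decode c) = Suc p" "walk T1 h1 (list_decode d) = Suc q"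
        by (meson not0_implies_Suc)
      have "\<not> (receive_state (F0 P) p \<and> receive_state (F1 P) q)"
        using short[rule_format, of "map tmsg (list_decode c)"] c cd run0[OF pq(1)] run1[OF pq(2)]
        unfolding same_code_iff A_def length_map by blast
      then show "\<not> (receive_code T0 (walk T0 h0 (list_decode c) - 1) \<and>
           receive_code T1 (walk T1 h1 (list_decode d) - 1))"
        using pq recv by simp
    qed
  qed
  then show ?thesis using check unfolding n_def by simp
qed

text \<open>The search tests the run characterisations on short runs, so one direction is
  restriction. Conversely, its success supplies the hypotheses of \<open>short_witness\<close> for
  both orders of the machines.\<close>

lemma check_correct:
  assumes P: "sr_pair P" and cyc: "\<not> has_send_cycle (F0 P)" "\<not> has_send_cycle (F1 P)"
  shows "check (enc_proto P) \<longleftrightarrow> affine P \<and> deadlock_free P"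
proof
  assume "affine P \<and> deadlock_free P"
  then show "check (enc_proto P)"
    unfolding check_iff_short_runs affine_iff_runs[OF P] deadlock_free_iff_runs[OF P]
    by (meson same_proj_sym)
next
  assume check: "check (enc_proto P)"
  let ?n = "enc_proto P"
  have "machine_pair (set (M_alpha P)) (msg_trans (F0 P)) (initial (F0 P)) (set (states (F0 P)))
    (msg_trans (F1 P)) (initial (F1 P)) (set (states (F1 P))) ?n"
    by (rule sr_pair_machine_pair[OF P cyc]) (auto intro: enc_proto_bounds enc_proto_msg_le)
  then interpret mp: machine_pair "set (M_alpha P)" "msg_trans (F0 P)" "initial (F0 P)" "set (states (F0 P))"
    "msg_trans (F1 P)" "initial (F1 P)" "set (states (F1 P))" ?n .
  interpret swap: machine_pair "- set (M_alpha P)" "msg_trans (F1 P)" "initial (F1 P)" "set (states (F1 P))"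
    "msg_trans (F0 P)" "initial (F0 P)" "set (states (F0 P))" ?n
    by (rule machine_pair_swap) (rule mp.machine_pair_axioms)
  note short = check[unfolded check_iff_short_runs, rule_format]
  have loops0: "\<exists>v. same_proj (set (M_alpha P)) u v \<and> run (msg_trans (F1 P)) (initial (F1 P)) v (initial (F1 P))"
    if "length u \<le> witness_bound ?n" "run (msg_trans (F0 P)) (initial (F0 P)) u (initial (F0 P))" for u
    using short[OF that(1)] that(2) by blast
  have loops1: "\<exists>u. same_proj (set (M_alpha P)) u v \<and> run (msg_trans (F0 P)) (initial (F0 P)) u (initial (F0 P))"
    if "length v \<le> witness_bound ?n" "run (msg_trans (F1 P)) (initial (F1 P)) v (initial (F1 P))" for v
    using short[OF that(1)] that(2) same_proj_sym by blast
  have all0: "(q = initial (F0 P) \<longrightarrow> mp.simulated u (initial (F1 P))) \<and>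
      (\<forall>r. mp.simulated u r \<longrightarrow> \<not> (receive_state (F0 P) q \<and> receive_state (F1 P) r))"
    if "run (msg_trans (F0 P)) (initial (F0 P)) u q" for u q
  proof (rule mp.short_witness[OF loops1 _ _ that])
    show "mp.simulated u (initial (F1 P))" if "length u \<le> witness_bound ?n"
      "run (msg_trans (F0 P)) (initial (F0 P)) u (initial (F0 P))" for u
      using loops0[OF that] unfolding mp.simulated_def .
    show "\<not> (receive_state (F0 P) q \<and> receive_state (F1 P) r)" if "length u \<le> witness_bound ?n"
      "run (msg_trans (F0 P)) (initial (F0 P)) u q" "mp.simulated u r" for u q r
      using short[OF that(1)] that(2,3) unfolding mp.simulated_def by blast
  qed
  \<comment> \<open>The exchanged pair has to give only the remaining inclusion of affineness;
    deadlocks are settled by \<open>all0\<close>, so \<open>R\<close> is trivial here.\<close>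
  have all1: "q = initial (F1 P) \<longrightarrow> swap.simulated u (initial (F0 P))"
    if "run (msg_trans (F1 P)) (initial (F1 P)) u q" for u q
  proof -
    have "\<exists>u. same_proj (- set (M_alpha P)) u v \<and> run (msg_trans (F1 P)) (initial (F1 P)) u (initial (F1 P))"
      if "length v \<le> witness_bound ?n" "run (msg_trans (F0 P)) (initial (F0 P)) v (initial (F0 P))" for v
      using loops0[OF that] same_proj_sym by auto
    moreover have "swap.simulated u (initial (F0 P))" if "length u \<le> witness_bound ?n"
      "run (msg_trans (F1 P)) (initial (F1 P)) u (initial (F1 P))" for u
      using loops1[OF that] same_proj_sym unfolding swap.simulated_def by auto
    ultimately show ?thesis
      using swap.short_witness[where R = "\<lambda>_ _. True", OF _ _ _ that] by blast
  qed
  have "affine P"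
    unfolding affine_iff_runs[OF P]
  proof (intro conjI allI impI)
    show "\<exists>v. same_proj (set (M_alpha P)) u v \<and> run (msg_trans (F1 P)) (initial (F1 P)) v (initial (F1 P))"
      if "run (msg_trans (F0 P)) (initial (F0 P)) u (initial (F0 P))" for u
      using all0[OF that] unfolding mp.simulated_def by simp
    show "\<exists>u. same_proj (set (M_alpha P)) u v \<and> run (msg_trans (F0 P)) (initial (F0 P)) u (initial (F0 P))"
      if "run (msg_trans (F1 P)) (initial (F1 P)) v (initial (F1 P))" for v
      using all1[OF that] same_proj_sym unfolding swap.simulated_def by auto
  qed
  moreover have "deadlock_free P"
    unfolding deadlock_free_iff_runs[OF P]
  proof (intro allI impI)
    show "\<not> (receive_state (F0 P) p \<and> receive_state (F1 P) q)"
      if "run (msg_trans (F0 P)) (initial (F0 P)) u p" "run (msg_trans (F1 P)) (initial (F1 P)) v q"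
        "same_proj (set (M_alpha P)) u v" for u v p q
      using all0[OF that(1)] that(2,3) unfolding mp.simulated_def by blast
  qed
  ultimately show "affine P \<and> deadlock_free P" by blast
qed

theorem theorem6p5:
  shows "\<exists>f. computable f \<and>
    (\<forall>P. sr_pair P \<and> \<not> has_send_cycle (F0 P) \<and> \<not> has_send_cycle (F1 P) \<longrightarrow>
         (f (enc_proto P) = 0 \<longleftrightarrow> affine P \<and> deadlock_free P))"
proof (intro exI conjI allI impI)
  \<comment> \<open>The value \<open>0\<close> stands for a positive answer, hence the
    negation.\<close>
  show "computable (\<lambda>x. of_bool (\<not> check x))"
    using decidable_not[OF decidable_check] unfolding decidable_def .
  show "(of_bool (\<not> check (enc_proto P)) = (0::nat)) = (affine P \<and> deadlock_free P)"
    if "sr_pair P \<and> \<not> has_send_cycle (F0 P) \<and> \<not> has_send_cycle (F1 P)" for P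
    using check_correct that by simp
qed

end
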